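(* Let $\omega$ be a weight of length $n\ge2$. The diagonal map $\triangle_\omega:K_\omega\to K_\omega\times K_\omega$ of the Loday realization $K_\omega$ satisfies $$\mathrm{Im}\,\triangle_\omega=\bigcup_{\substack{\mathrm{top}\,F\le\mathrm{bot}\,G\\ \dim F+\dim G=n-2}}F\times G ,$$ where the union runs over pairs $(F,G)$ of faces of $K_\omega$ satisfying the two displayed conditions, and $\le$ is the Tamari order on the vertices of $K_\omega$.
   Context: **Trees.** $\mathrm{PBT}_n$ is the set of planar binary rooted trees with $n$ leaves. The Tamari order on $\mathrm{PBT}_n$ is the partial order generated by the covering relations $s\prec t$ where $t$ is obtained from $s$ by replacing, somewhere in the tree, a subtree of the form $(t_1\,t_2)\,t_3$ by $t_1\,(t_2\,t_3)$ (the $t_i$ being planar binary trees). **Loday realizations.** A weight of length $n$ is $\omega=(\omega_1,\dots,\omega_n)\in\mathbb{Z}_{>0}^n$. Order the $n-1$ vertices of $t\in\mathrm{PBT}_n$ from left to right (the $i$-th vertex separates the $i$-th and $(i+1)$-st leaves). Let $\alpha_i$ (resp. $\beta_i$) be the sum of the weights of the leaves supported by the left (resp. right) input of the $i$-th vertex, and $M(t,\omega)=(\alpha_1\beta_1,\dots,\alpha_{n-1}\beta_{n-1})\in\mathbb{R}^{n-1}$. Then $K_\omega=\mathrm{conv}\{M(t,\omega)\mid t\in\mathrm{PBT}_n\}$. It is a polytope of dimension $n-2$ whose vertices are the points $M(t,\omega)$, identified with the trees $t$. **Diagonal.** Fix any $\vec v\in\mathbb{R}^{n-1}$ with $v_1>\dots>v_{n-1}$.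 For a polytope $R$ with no edge perpendicular to $\vec v$, $\mathrm{top}\,R$ (resp. $\mathrm{bot}\,R$) is the unique vertex of $R$ maximizing (resp. minimizing) $\langle\cdot,\vec v\rangle$. This applies to the faces of $K_\omega$ and to the polytopes $K_\omega\cap\rho_zK_\omega$, where $\rho_zK_\omega=2z-K_\omega$, $z\in K_\omega$. The diagonal is $\triangle_\omega(z)=\big(\mathrm{bot}(K_\omega\cap\rho_zK_\omega),\,\mathrm{top}(K_\omega\cap\rho_zK_\omega)\big)$; it does not depend on the choice of $\vec v$. *)

theory Defs
  imports "HOL-Analysis.Analysis"
begin

datatype pbt = Leaf | Node pbt pbt

fun leaves :: "pbt \<Rightarrow> nat" where
  "leaves Leaf = 1"
| "leaves (Node l r) = leaves l + leaves r"

definition PBT :: "nat \<Rightarrow> pbt set" where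
  "PBT n = {t. leaves t = n}"

inductive tamari_cover :: "pbt \<Rightarrow> pbt \<Rightarrow> bool" where
  rotate: "tamari_cover (Node (Node t1 t2) t3) (Node t1 (Node t2 t3))"
| left: "tamari_cover s s' \<Longrightarrow> tamari_cover (Node s t) (Node s' t)"
| right: "tamari_cover t t' \<Longrightarrow> tamari_cover (Node s t) (Node s t')"

definition tamari_le :: "pbt \<Rightarrow> pbt \<Rightarrow> bool" where
  "tamari_le = tamari_cover\<^sup>*\<^sup>*"

definition is_weight :: "nat \<Rightarrow> nat list \<Rightarrow> bool" where
  "is_weight n \<omega> \<longleftrightarrow> length \<omega> = n \<and> (\<forall>w\<in>set \<omega>. 0 < w)"

text \<open>
  The products \<open>\<alpha>\<^sub>i * \<beta>\<^sub>i\<close>, listed from left to right. The leaves of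
  \<open>Node l r\<close> are those of \<open>l\<close> followed by those of \<open>r\<close>, so the weights are split
  accordingly; the root is the vertex separating the two blocks.
\<close>

fun loday_coords :: "pbt \<Rightarrow> nat list \<Rightarrow> nat list" where
  "loday_coords Leaf \<omega> = []"
| "loday_coords (Node l r) \<omega> =
     loday_coords l (take (leaves l) \<omega>)
     @ [sum_list (take (leaves l) \<omega>) * sum_list (drop (leaves l) \<omega>)]
     @ loday_coords r (drop (leaves l) \<omega>)"

text \<open>
  The space of dimension \<open>n - 1\<close> is \<open>real ^ 'm\<close> for a finite linearly ordered type
  \<open>'m\<close> with \<open>n - 1\<close> elements. The order on \<open>'m\<close> is the order of the coordinates:
  \<open>card {j. j < i}\<close> is the position of \<open>i\<close>, counted from \<open>0\<close>.
\<close>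

definition loday_vertex :: "pbt \<Rightarrow> nat list \<Rightarrow> real ^ 'm::{finite,linorder}" where
  "loday_vertex t \<omega> = (\<chi> i. real (loday_coords t \<omega> ! card {j. j < i}))"

definition loday_polytope :: "nat list \<Rightarrow> (real ^ 'm::{finite,linorder}) set" where
  "loday_polytope \<omega> = convex hull ((\<lambda>t. loday_vertex t \<omega>) ` PBT (length \<omega>))"

definition vertex_le ::
    "nat list \<Rightarrow> real ^ 'm::{finite,linorder} \<Rightarrow> real ^ 'm::{finite,linorder} \<Rightarrow> bool" where
  "vertex_le \<omega> x y \<longleftrightarrow>
     (\<exists>s \<in> PBT (length \<omega>). \<exists>t \<in> PBT (length \<omega>).
        x = loday_vertex s \<omega> \<and> y = loday_vertex t \<omega> \<and> tamari_le s t)"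

definition top_vertex :: "'a::euclidean_space \<Rightarrow> 'a set \<Rightarrow> 'a" where
  "top_vertex v R = (THE x. x extreme_point_of R \<and> (\<forall>y\<in>R. y \<bullet> v \<le> x \<bullet> v))"

definition bot_vertex :: "'a::euclidean_space \<Rightarrow> 'a set \<Rightarrow> 'a" where
  "bot_vertex v R = (THE x. x extreme_point_of R \<and> (\<forall>y\<in>R. x \<bullet> v \<le> y \<bullet> v))"

definition point_reflection :: "'a::euclidean_space \<Rightarrow> 'a set \<Rightarrow> 'a set" where
  "point_reflection z R = (\<lambda>x. 2 *\<^sub>R z - x) ` R"

definition diagonal :: "'a::euclidean_space \<Rightarrow> 'a set \<Rightarrow> 'a \<Rightarrow> 'a \<times> 'a" where
  "diagonal v K z =
     (bot_vertex v (K \<inter> point_reflection z K), top_vertex v (K \<inter> point_reflection z K))"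

end

theory Submission
  imports Defs
begin

text \<open>
  Number the leaves \<open>0, \<dots>, m\<close> with \<open>m = n - 1\<close> and pass from a point \<open>x\<close> to its partial sums
  \<open>D\<^sub>k = x\<^sub>1 + \<dots> + x\<^sub>k\<close>. In these coordinates the Loday polytope is given by difference
  constraints \<open>D\<^sub>q - D\<^sub>p \<ge> f p q\<close>, with \<open>D\<^sub>0\<close> and \<open>D\<^sub>m\<close> fixed and \<open>f\<close> strictly supermodular. Hence the
  tight constraints at a point form a laminar family of intervals, and every set cut out by such
  constraints, in particular a face or the intersection with a point reflection, is closed under
  pointwise maxima and minima of \<open>D\<close>. A decreasing vector pairs with \<open>D\<close> through positive coefficients, so
  tops and bottoms are pointwise maxima and minima of \<open>D\<close>.

  By a perturbation argument, \<open>(x, y)\<close> lies in the image of the diagonal iff every leaf can be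
  reached from leaf \<open>0\<close> along the tight intervals of \<open>x\<close> traversed forwards and those of \<open>y\<close> traversed
  backwards. For laminar families this reachability is equivalent to a comparison of right
  endpoints of intervals, which for the tight families of two faces expresses that the top of the
  first is below the bottom of the second in the Tamari order. The dimension condition comes from
  choosing a spanning arborescence, since a face with \<open>k\<close> tight intervals has dimension \<open>m - k\<close>.
\<close>

section \<open>The Tamari order through right extents\<close>

lemma leaves_pos [simp]: "0 < leaves t"
  by (induction t) auto

lemma length_loday_coords:
  "length \<omega> = leaves t \<Longrightarrow> length (loday_coords t \<omega>) = leaves t - 1"
proof (induction t arbitrary: \<omega>)
  case (Node l r)
  then show ?case using leaves_pos[of l] leaves_pos[of r] by (auto simp del: leaves_pos)
qed auto

text \<open>The last leaf below the \<open>i\<close>-th vertex, where leaves are numbered from \<open>0\<close> and vertices from \<open>1\<close>,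
  so that vertex \<open>i\<close> separates the leaves \<open>i - 1\<close> and \<open>i\<close>. Other indices give junk.\<close>

fun right_extent :: "pbt \<Rightarrow> nat \<Rightarrow> nat" where
  "right_extent Leaf i = 0"
| "right_extent (Node l r) i =
     (if i < leaves l then right_extent l i
      else if i = leaves l then leaves l + leaves r - 1
      else leaves l + right_extent r (i - leaves l))"

lemma right_extent_less: "right_extent t i < leaves t"
proof (induction t arbitrary: i)
  case (Node l r)
  then show ?case using leaves_pos[of l] leaves_pos[of r]
    by (auto simp: trans_less_add1 simp del: leaves_pos)
qed auto

lemma right_extent_ge: "i < leaves t \<Longrightarrow> i \<le> right_extent t i"
proof (induction t arbitrary: i)
  case (Node l r)
  have "i - leaves l \<le> right_extent r (i - leaves l)" if "leaves l < i"
    using Node.prems that by (intro Node.IH) auto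
  moreover have "i \<le> right_extent l i" if "i < leaves l"
    using Node.IH(1) that by blast
  ultimately show ?case using leaves_pos[of r] by (simp del: leaves_pos) linarith
qed auto

lemma tamari_cover_leaves: "tamari_cover s t \<Longrightarrow> leaves s = leaves t"
  by (induction rule: tamari_cover.induct) auto

text \<open>Only the vertex between \<open>t1\<close> and \<open>t2\<close> changes its extent under
  a rotation: it moves from the last leaf of \<open>t2\<close> to the last leaf of
  \<open>t3\<close>.\<close>

lemma tamari_cover_right_extent:
  "tamari_cover s t \<Longrightarrow> right_extent s i \<le> right_extent t i"
proof (induction arbitrary: i rule: tamari_cover.induct)
  case (rotate t1 t2 t3)
  then show ?case
    using right_extent_less[of t1 i] right_extent_less[of t2 "i - leaves t1"]
    by auto
qed (auto dest: tamari_cover_leaves)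

lemma tamari_le_right_extent:
  "tamari_le s t \<Longrightarrow> right_extent s i \<le> right_extent t i"
  unfolding tamari_le_def
  by (induction rule: rtranclp_induct) (auto intro: order_trans tamari_cover_right_extent)

lemma tamari_le_refl [simp]: "tamari_le t t"
  by (simp add: tamari_le_def)

lemma tamari_le_trans: "tamari_le s t \<Longrightarrow> tamari_le t u \<Longrightarrow> tamari_le s u"
  by (simp add: tamari_le_def)

lemma tamari_le_Node:
  assumes "tamari_le s s'" "tamari_le t t'"
  shows "tamari_le (Node s t) (Node s' t')"
proof -
  have "tamari_le (Node s t) (Node s' t)"
    using assms(1) unfolding tamari_le_def
    by (induction rule: rtranclp_induct) (auto intro: rtranclp.rtrancl_into_rtrancl tamari_cover.left)
  moreover have "tamari_le (Node s' t) (Node s' t')"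
    using assms(2) unfolding tamari_le_def
    by (induction rule: rtranclp_induct) (auto intro: rtranclp.rtrancl_into_rtrancl tamari_cover.right)
  ultimately show ?thesis by (rule tamari_le_trans)
qed

text \<open>Rotations lift the \<open>k\<close>-th vertex to the root.\<close>

lemma tamari_le_split:
  assumes "0 < k" "k < leaves s" "\<And>i. 0 < i \<Longrightarrow> i < k \<Longrightarrow> right_extent s i < k"
  shows "\<exists>a b. leaves a = k \<and> leaves a + leaves b = leaves s \<and> tamari_le s (Node a b) \<and>
    (\<forall>i<k. right_extent a i = right_extent s i) \<and>
    (\<forall>i. 0 < i \<longrightarrow> k + right_extent b i = right_extent s (k + i))"
  using assms
proof (induction s arbitrary: k)
  case (Node l r)
  consider "leaves l = k" | "leaves l < k" | "k < leaves l" by linarith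
  then show ?case
  proof cases
    case 1
    then show ?thesis by (intro exI[of _ l] exI[of _ r]) auto
  next
    case 2
    \<comment> \<open>The root of \<open>s\<close> would lie strictly left of \<open>k\<close> with
      the last leaf as its extent, against the hypothesis.\<close>
    then show ?thesis using Node.prems(3)[of "leaves l"] Node.prems(2) by auto
  next
    case 3
    have "\<And>i. 0 < i \<Longrightarrow> i < k \<Longrightarrow> right_extent l i < k"
      using Node.prems(3) 3 by (metis dual_order.strict_trans right_extent.simps(2))
    from Node.IH(1)[OF Node.prems(1) 3 this] obtain a b where ab:
      "leaves a = k" "leaves a + leaves b = leaves l" "tamari_le l (Node a b)"
      "\<forall>i<k. right_extent a i = right_extent l i"
      "\<forall>i. 0 < i \<longrightarrow> k + right_extent b i = right_extent l (k + i)"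
      by blast
    have "tamari_le (Node l r) (Node (Node a b) r)"
      using ab(3) by (intro tamari_le_Node) auto
    moreover have "tamari_le (Node (Node a b) r) (Node a (Node b r))"
      by (auto simp: tamari_le_def intro: rotate)
    ultimately have "tamari_le (Node l r) (Node a (Node b r))"
      by (rule tamari_le_trans)
    moreover have "k + right_extent (Node b r) i = right_extent (Node l r) (k + i)" if "0 < i" for i
      using ab(5)[rule_format, OF that] ab(1) leaves_pos[of r]
      by (auto simp: ab(2)[symmetric]  simp del: leaves_pos)
    ultimately show ?thesis
      using ab(1,2,4) 3 by (intro exI[of _ a] exI[of _ "Node b r"]) auto
  qed
qed auto

text \<open>Vertices left of the root of \<open>t\<close> have extents short of it in
  \<open>t\<close>, hence also in \<open>s\<close>, so \<open>tamari_le_split\<close> applies to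
  \<open>s\<close> at that position; the two subtrees are then compared recursively. Together with
  \<open>tamari_le_right_extent\<close> this makes the Tamari order the pointwise order of
  extents.\<close>

lemma right_extent_imp_tamari_le:
  assumes "leaves s = leaves t"
    and "\<And>i. 0 < i \<Longrightarrow> i < leaves t \<Longrightarrow> right_extent s i \<le> right_extent t i"
  shows "tamari_le s t"
  using assms
proof (induction t arbitrary: s)
  case Leaf
  have "s = Leaf"
  proof (cases s)
    case (Node a b)
    then show ?thesis using Leaf(1) leaves_pos[of a] leaves_pos[of b]
      by (simp del: leaves_pos)
  qed
  then show ?case by simp
next
  case (Node l r)
  define k where "k = leaves l"
  have k: "0 < k" "k < leaves s" by (auto simp: k_def Node.prems)
  have "right_extent s i < k" if "0 < i" "i < k" for i
    using Node.prems(2)[of i] that right_extent_less[of l i] by (auto simp: k_def)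
  from tamari_le_split[OF k this] obtain a b where ab:
    "leaves a = k" "leaves a + leaves b = leaves s" "tamari_le s (Node a b)"
    "\<forall>i<k. right_extent a i = right_extent s i"
    "\<forall>i. 0 < i \<longrightarrow> k + right_extent b i = right_extent s (k + i)"
    by blast
  have "tamari_le a l"
  proof (rule Node.IH(1))
    fix i assume "0 < i" "i < leaves l"
    then show "right_extent a i \<le> right_extent l i"
      using ab(4) Node.prems(2)[of i] by (auto simp: k_def)
  qed (use ab(1) k_def in simp)
  moreover have "tamari_le b r"
  proof (rule Node.IH(2))
    show "leaves b = leaves r" using ab(1,2) Node.prems(1) by (simp add: k_def)
    fix i assume "0 < i" "i < leaves r"
    then show "right_extent b i \<le> right_extent r i"
      using ab(5)[rule_format, of i] Node.prems(2)[of "k + i"] by (auto simp: k_def)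
  qed
  ultimately show ?case
    using ab(3) tamari_le_Node tamari_le_trans by blast
qed

section \<open>Partial sums of the Loday coordinates\<close>

definition weight_sum :: "nat list \<Rightarrow> nat \<Rightarrow> real" where
  "weight_sum \<omega> k = (\<Sum>a<k. real (\<omega> ! a))"

text \<open>This is \<open>\<Sum>p\<le>a<b\<le>q. \<omega>\<^sub>a \<omega>\<^sub>b\<close>.\<close>

definition pair_sum :: "nat list \<Rightarrow> nat \<Rightarrow> nat \<Rightarrow> real" where
  "pair_sum \<omega> p q =
     ((weight_sum \<omega> (Suc q) - weight_sum \<omega> p)\<^sup>2 - (\<Sum>a\<in>{p..q}. (real (\<omega> ! a))\<^sup>2)) / 2"

definition coord_sum :: "pbt \<Rightarrow> nat list \<Rightarrow> nat \<Rightarrow> real" where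
  "coord_sum t \<omega> k = (\<Sum>j<k. real (loday_coords t \<omega> ! j))"

lemma pair_sum_self [simp]: "pair_sum \<omega> p p = 0"
  by (simp add: pair_sum_def weight_sum_def)

text \<open>A pair of leaves in \<open>p..q\<close> lies before \<open>k\<close>, from
  \<open>k\<close> on, or on both sides of \<open>k\<close>; the product counts the last
  kind.\<close>

lemma pair_sum_split:
  assumes "p < k" "k \<le> q"
  shows "pair_sum \<omega> p q = pair_sum \<omega> p (k - 1) + pair_sum \<omega> k q +
    (weight_sum \<omega> k - weight_sum \<omega> p) * (weight_sum \<omega> (Suc q) - weight_sum \<omega> k)"
proof -
  have "{p..q} = {p..k - 1} \<union> {k..q}" "{p..k - 1} \<inter> {k..q} = {}" using assms by auto
  then have "(\<Sum>a\<in>{p..q}. (real (\<omega> ! a))\<^sup>2) =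
      (\<Sum>a\<in>{p..k - 1}. (real (\<omega> ! a))\<^sup>2) + (\<Sum>a\<in>{k..q}. (real (\<omega> ! a))\<^sup>2)"
    by (simp add: sum.union_disjoint)
  then show ?thesis using assms by (simp add: pair_sum_def power2_eq_square field_simps)
qed

text \<open>The product counts the pairs with one leaf in \<open>p..<p'\<close> and the other in
  \<open>Suc q..q'\<close>, the only pairs inside \<open>p..q'\<close> contained in neither
  \<open>p..q\<close> nor \<open>p'..q'\<close>. This is supermodularity, strict for positive
  weights when \<open>p < p'\<close> and \<open>q < q'\<close>.\<close>

lemma pair_sum_crossing:
  assumes "p \<le> p'" "p' \<le> q" "q \<le> q'"
  shows "pair_sum \<omega> p q' + pair_sum \<omega> p' q = pair_sum \<omega> p q + pair_sum \<omega> p' q' +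
    (weight_sum \<omega> p' - weight_sum \<omega> p) * (weight_sum \<omega> (Suc q') - weight_sum \<omega> (Suc q))"
proof -
  define h where "h a = (real (\<omega> ! a))\<^sup>2" for a
  have "{p..q} \<union> {p'..q'} = {p..q'}" "{p..q} \<inter> {p'..q'} = {p'..q}" using assms by auto
  then have "sum h {p..q'} + sum h {p'..q} = sum h {p..q} + sum h {p'..q'}"
    by (metis finite_atLeastAtMost sum.union_inter)
  then show ?thesis by (simp add: pair_sum_def flip: h_def) (simp add: power2_eq_square field_simps)
qed

lemma weight_sum_0 [simp]: "weight_sum \<omega> 0 = 0"
  by (simp add: weight_sum_def)

lemma weight_sum_mono: "j \<le> k \<Longrightarrow> weight_sum \<omega> j \<le> weight_sum \<omega> k"
  unfolding weight_sum_def by (intro sum_mono2) auto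

lemma weight_sum_strict_mono:
  assumes "j < k" "k \<le> length \<omega>" "\<forall>w\<in>set \<omega>. 0 < w"
  shows "weight_sum \<omega> j < weight_sum \<omega> k"
  unfolding weight_sum_def using assms
  by (intro sum_strict_mono2[of _ _ j]) auto

lemma weight_sum_take: "j \<le> k \<Longrightarrow> weight_sum (take k \<omega>) j = weight_sum \<omega> j"
  by (simp add: weight_sum_def)

lemma weight_sum_drop:
  assumes "k + j \<le> length \<omega>"
  shows "weight_sum (drop k \<omega>) j = weight_sum \<omega> (k + j) - weight_sum \<omega> k"
  using assms by (induction j) (auto simp: weight_sum_def)

lemma weight_sum_length: "weight_sum \<omega> (length \<omega>) = real (sum_list \<omega>)"
  by (simp add: weight_sum_def sum_list_sum_nth atLeast0LessThan)

lemma pair_sum_take: "p \<le> q \<Longrightarrow> q < k \<Longrightarrow> pair_sum (take k \<omega>) p q = pair_sum \<omega> p q"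
  by (simp add: pair_sum_def weight_sum_take)

lemma pair_sum_drop:
  assumes "p \<le> q" "k + q < length \<omega>"
  shows "pair_sum (drop k \<omega>) p q = pair_sum \<omega> (k + p) (k + q)"
proof -
  have "(\<Sum>a\<in>{p..q}. (real (drop k \<omega> ! a))\<^sup>2) = (\<Sum>a\<in>{k + p..k + q}. (real (\<omega> ! a))\<^sup>2)"
    using assms sum.shift_bounds_cl_nat_ivl[of "\<lambda>a. (real (\<omega> ! a))\<^sup>2" p k q]
    by (simp add: add.commute)
  then show ?thesis using assms by (simp add: pair_sum_def weight_sum_drop)
qed

section \<open>Partial sums of the coordinates of a tree and their lower bounds\<close>

lemma coord_sum_Node_left:
  assumes "length \<omega> = leaves l + leaves r" "j < leaves l"
  shows "coord_sum (Node l r) \<omega> j = coord_sum l (take (leaves l) \<omega>) j"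
proof -
  have "length (loday_coords l (take (leaves l) \<omega>)) = leaves l - 1"
    using assms by (simp add: length_loday_coords)
  then show ?thesis using assms(2)
    unfolding coord_sum_def by (intro sum.cong) (auto simp: nth_append)
qed

lemma coord_sum_Node_right:
  assumes "length \<omega> = leaves l + leaves r" "j < leaves r"
  shows "coord_sum (Node l r) \<omega> (leaves l + j) =
    coord_sum l (take (leaves l) \<omega>) (leaves l - 1) +
    weight_sum \<omega> (leaves l) * (weight_sum \<omega> (leaves l + leaves r) - weight_sum \<omega> (leaves l)) +
    coord_sum r (drop (leaves l) \<omega>) j"
  using assms(2)
proof (induction j)
  case 0
  have W: "real (sum_list (take (leaves l) \<omega>)) = weight_sum \<omega> (leaves l)"
    "real (sum_list (drop (leaves l) \<omega>)) =
      weight_sum \<omega> (leaves l + leaves r) - weight_sum \<omega> (leaves l)"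
    using assms(1) weight_sum_length[of "take (leaves l) \<omega>"] weight_sum_length[of "drop (leaves l) \<omega>"]
    by (simp_all add: weight_sum_take weight_sum_drop)
  obtain k where k: "leaves l = Suc k" using leaves_pos[of l] gr0_conv_Suc by blast
  have len: "length (loday_coords l (take (leaves l) \<omega>)) = k"
    using assms(1) k by (simp add: length_loday_coords)
  have "(\<Sum>j<k. real (loday_coords (Node l r) \<omega> ! j)) = coord_sum l (take (leaves l) \<omega>) k"
    unfolding coord_sum_def using len by (intro sum.cong) (auto simp: nth_append)
  moreover have "loday_coords (Node l r) \<omega> ! k =
      sum_list (take (leaves l) \<omega>) * sum_list (drop (leaves l) \<omega>)"
    using len by (simp add: nth_append)
  ultimately show ?case using k W by (simp add: coord_sum_def)
next
  case (Suc j)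
  have "length (loday_coords l (take (leaves l) \<omega>)) = leaves l - 1"
    using assms by (simp add: length_loday_coords)
  then have "loday_coords (Node l r) \<omega> ! (leaves l + j) = loday_coords r (drop (leaves l) \<omega>) ! j"
    using leaves_pos[of l] by (simp add: nth_append_right del: leaves_pos)
  then show ?case using Suc by (simp add: coord_sum_def)
qed

lemma coord_sum_0 [simp]: "coord_sum t \<omega> 0 = 0"
  by (simp add: coord_sum_def)

text \<open>Each pair of leaves is separated by exactly one vertex, so its product enters exactly
  one coordinate, whatever the tree.\<close>

lemma coord_sum_total:
  "length \<omega> = leaves t \<Longrightarrow> coord_sum t \<omega> (leaves t - 1) = pair_sum \<omega> 0 (leaves t - 1)"
proof (induction t arbitrary: \<omega>)
  case (Node l r)
  have e: "leaves (Node l r) - 1 = leaves l + (leaves r - 1)" "leaves l - 1 < leaves l"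
    "Suc (leaves l + (leaves r - 1)) = leaves l + leaves r"
    using leaves_pos[of l] leaves_pos[of r] by (simp_all del: leaves_pos)
  have len: "length (take (leaves l) \<omega>) = leaves l" "length (drop (leaves l) \<omega>) = leaves r"
    using Node.prems by auto
  have "coord_sum (Node l r) \<omega> (leaves l + (leaves r - 1)) =
      pair_sum \<omega> 0 (leaves l - 1) +
      weight_sum \<omega> (leaves l) * (weight_sum \<omega> (leaves l + leaves r) - weight_sum \<omega> (leaves l)) +
      pair_sum \<omega> (leaves l) (leaves l + (leaves r - 1))"
    using Node.prems e Node.IH(1)[OF len(1)] Node.IH(2)[OF len(2)]
    by (simp add: coord_sum_Node_right pair_sum_take pair_sum_drop)
  also have "\<dots> = pair_sum \<omega> 0 (leaves l + (leaves r - 1))"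
  proof -
    define q where "q = leaves l + (leaves r - 1)"
    have "Suc q = leaves l + leaves r" "leaves l \<le> q" using e(3) by (auto simp: q_def)
    then show ?thesis
      using pair_sum_split[of 0 "leaves l" q \<omega>] unfolding q_def[symmetric] by simp
  qed
  finally show ?case using e by simp
qed (simp add: coord_sum_def)

text \<open>Two leaves of \<open>p..q\<close> are separated by a vertex \<open>i\<close> with
  \<open>p < i \<le> q\<close>, so their product enters one of the coordinates summed on the right;
  whatever else these contain is nonnegative. The induction distinguishes the position of the
  root.\<close>

lemma coord_sum_ge:
  "length \<omega> = leaves t \<Longrightarrow> p \<le> q \<Longrightarrow> q < leaves t \<Longrightarrow>
    pair_sum \<omega> p q \<le> coord_sum t \<omega> q - coord_sum t \<omega> p"
proof (induction t arbitrary: \<omega> p q)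
  case (Node l r)
  define k where "k = leaves l"
  have len: "length (take k \<omega>) = leaves l" "length (drop k \<omega>) = leaves r"
    using Node.prems by (auto simp: k_def)
  have kpos: "0 < k" by (simp add: k_def)
  consider "q < k" | "p < k" "k \<le> q" | "k \<le> p" by linarith
  then show ?case
  proof cases
    case 1
    then show ?thesis using Node.IH(1)[OF len(1), of p q] Node.prems
      by (simp add: coord_sum_Node_left pair_sum_take k_def)
  next
    case 2
    then obtain j where j: "q = k + j" by (metis le_Suc_ex)
    have jr: "j < leaves r" using Node.prems j by (simp add: k_def)
    have "pair_sum \<omega> p (k - 1) \<le> coord_sum l (take k \<omega>) (k - 1) - coord_sum l (take k \<omega>) p"
      using Node.IH(1)[OF len(1), of p "k - 1"] 2 kpos by (simp add: pair_sum_take k_def)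
    moreover have "pair_sum \<omega> k q \<le> coord_sum r (drop k \<omega>) j"
      using Node.IH(2)[OF len(2), of 0 j] jr Node.prems by (simp add: pair_sum_drop j k_def)
    moreover have "(weight_sum \<omega> k - weight_sum \<omega> p) * (weight_sum \<omega> (Suc q) - weight_sum \<omega> k)
        \<le> weight_sum \<omega> k * (weight_sum \<omega> (k + leaves r) - weight_sum \<omega> k)"
    proof (rule mult_mono)
      show "weight_sum \<omega> k - weight_sum \<omega> p \<le> weight_sum \<omega> k"
        "0 \<le> weight_sum \<omega> k" by (auto simp: weight_sum_def intro: sum_nonneg)
      show "weight_sum \<omega> (Suc q) - weight_sum \<omega> k \<le> weight_sum \<omega> (k + leaves r) - weight_sum \<omega> k"
        using j jr by (auto intro: weight_sum_mono)
      show "0 \<le> weight_sum \<omega> (Suc q) - weight_sum \<omega> k"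
        using j by (auto intro: weight_sum_mono)
    qed
    ultimately show ?thesis
      using pair_sum_split[of p k q \<omega>] 2 Node.prems jr
        coord_sum_Node_left[of \<omega> l r p] coord_sum_Node_right[of \<omega> l r j]
      by (simp add: j k_def)
  next
    case 3
    then obtain i j where ij: "p = k + i" "q = k + j"
      using Node.prems(2) by (metis le_Suc_ex le_trans)
    then show ?thesis
      using Node.IH(2)[OF len(2), of i j] Node.prems
        coord_sum_Node_right[of \<omega> l r i] coord_sum_Node_right[of \<omega> l r j]
        pair_sum_drop[of i j k \<omega>]
      by (simp add: k_def)
  qed
qed auto

text \<open>The leaves from \<open>i\<close> to its extent are the right input of vertex
  \<open>i\<close>; with \<open>a\<close> the first leaf below that vertex, those from
  \<open>a\<close> on are all the leaves below it. On the leaf block of a subtree the bound of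
  \<open>coord_sum_ge\<close> is attained, by \<open>coord_sum_total\<close> for that
  subtree.\<close>

lemma coord_sum_right_extent:
  "length \<omega> = leaves t \<Longrightarrow> 0 < i \<Longrightarrow> i < leaves t \<Longrightarrow>
    coord_sum t \<omega> (right_extent t i) - coord_sum t \<omega> i = pair_sum \<omega> i (right_extent t i) \<and>
    (\<exists>a<i. coord_sum t \<omega> (right_extent t i) - coord_sum t \<omega> a = pair_sum \<omega> a (right_extent t i))"
proof (induction t arbitrary: \<omega> i)
  case (Node l r)
  define k where "k = leaves l"
  have len: "length (take k \<omega>) = leaves l" "length (drop k \<omega>) = leaves r"
    using Node.prems by (auto simp: k_def)
  have kpos: "0 < k" by (simp add: k_def)
  consider "i < k" | "i = k" | "k < i" by linarith
  then show ?case
  proof cases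
    case 1
    have less: "right_extent l i < k" by (simp add: k_def right_extent_less)
    have ge: "i \<le> right_extent l i" using 1 by (simp add: k_def right_extent_ge)
    from Node.IH(1)[OF len(1), of i] 1 Node.prems obtain a where a: "a < i"
      "coord_sum l (take k \<omega>) (right_extent l i) - coord_sum l (take k \<omega>) i =
        pair_sum (take k \<omega>) i (right_extent l i)"
      "coord_sum l (take k \<omega>) (right_extent l i) - coord_sum l (take k \<omega>) a =
        pair_sum (take k \<omega>) a (right_extent l i)" by (auto simp: k_def)
    have "coord_sum (Node l r) \<omega> b = coord_sum l (take k \<omega>) b" if "b < k" for b
      using that Node.prems by (simp add: coord_sum_Node_left k_def)
    then show ?thesis
      using a 1 less ge by (intro conjI exI[of _ a]) (auto simp: pair_sum_take simp flip: k_def)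
  next
    case 2
    define q where "q = leaves r - 1"
    have q: "q < leaves r" "k + leaves r - 1 = k + q" "leaves r - Suc 0 = q"
      using leaves_pos[of r] by (simp_all add: q_def del: leaves_pos)
    have "coord_sum (Node l r) \<omega> (k + q) - coord_sum (Node l r) \<omega> (k + 0) =
        coord_sum r (drop k \<omega>) q - coord_sum r (drop k \<omega>) 0"
      using Node.prems q(1) coord_sum_Node_right[of \<omega> l r q] coord_sum_Node_right[of \<omega> l r 0]
      by (simp add: k_def)
    also have "\<dots> = pair_sum \<omega> (k + 0) (k + q)"
      using coord_sum_total[OF len(2)] pair_sum_drop[of 0 q k \<omega>] q Node.prems by (simp add: k_def)
    finally have "coord_sum (Node l r) \<omega> (k + q) - coord_sum (Node l r) \<omega> k = pair_sum \<omega> k (k + q)"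
      by simp
    moreover have "coord_sum (Node l r) \<omega> (k + q) - coord_sum (Node l r) \<omega> 0 = pair_sum \<omega> 0 (k + q)"
      using coord_sum_total[OF Node.prems(1)] q(2) by (simp add: k_def)
    moreover have "right_extent (Node l r) i = k + q" using 2 q(2) by (simp add: k_def)
    ultimately show ?thesis using 2 kpos by metis
  next
    case 3
    then obtain j where j: "i = k + j" "0 < j" by (metis less_imp_add_positive)
    have jr: "j < leaves r" using Node.prems j by (simp add: k_def)
    have rj: "right_extent r j < leaves r" by (rule right_extent_less)
    have re: "right_extent (Node l r) i = k + right_extent r j" using j by (simp add: k_def)
    have drop: "coord_sum (Node l r) \<omega> (k + b) - coord_sum (Node l r) \<omega> (k + a) =
        coord_sum r (drop k \<omega>) b - coord_sum r (drop k \<omega>) a"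
      if "a < leaves r" "b < leaves r" for a b
      using that Node.prems by (simp add: coord_sum_Node_right k_def)
    have pd: "pair_sum \<omega> (k + a) (k + right_extent r j) = pair_sum (drop k \<omega>) a (right_extent r j)"
      if "a \<le> j" for a
    proof (subst pair_sum_drop)
      show "a \<le> right_extent r j" using that right_extent_ge[OF jr] by simp
      show "k + right_extent r j < length \<omega>" using rj Node.prems by (simp add: k_def)
    qed simp
    from Node.IH(2)[OF len(2) j(2) jr] obtain a where a: "a < j"
      "coord_sum r (drop k \<omega>) (right_extent r j) - coord_sum r (drop k \<omega>) j =
        pair_sum (drop k \<omega>) j (right_extent r j)"
      "coord_sum r (drop k \<omega>) (right_extent r j) - coord_sum r (drop k \<omega>) a =
        pair_sum (drop k \<omega>) a (right_extent r j)" by blast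
    show ?thesis unfolding re unfolding j(1)
      using a jr rj drop[of j "right_extent r j"] drop[of a "right_extent r j"] pd[of j] pd[of a]
      by (intro conjI exI[of _ "k + a"]) auto
  qed
qed auto

section \<open>Laminar families of intervals\<close>

text \<open>A pair \<open>(p, q)\<close> stands for the block of leaves \<open>p..q\<close>, so
  blocks sharing a single end leaf, such as \<open>(p, q)\<close> and \<open>(q, r)\<close> with
  \<open>p < q < r\<close>, already cross.\<close>

definition laminar :: "(nat \<times> nat) set \<Rightarrow> bool" where
  "laminar E \<longleftrightarrow> (\<forall>(p, q)\<in>E. \<forall>(p', q')\<in>E. \<not> (p < p' \<and> p' \<le> q \<and> q < q'))"

definition ivals :: "nat \<Rightarrow> (nat \<times> nat) set" where
  "ivals m = {(p, q). p < q \<and> q \<le> m}"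

inductive_set reach :: "(nat \<times> nat) set \<Rightarrow> (nat \<times> nat) set \<Rightarrow> nat set" for A B where
  zero: "0 \<in> reach A B"
| forward: "p \<in> reach A B \<Longrightarrow> (p, q) \<in> A \<Longrightarrow> q \<in> reach A B"
| backward: "q \<in> reach A B \<Longrightarrow> (p, q) \<in> B \<Longrightarrow> p \<in> reach A B"

text \<open>For the tight families of two faces, this compares the right extent of vertex \<open>i\<close> in the top of
  the first with that in the bottom of the second; \<open>r = i\<close> stands for a single leaf.\<close>

definition linked :: "nat \<Rightarrow> (nat \<times> nat) set \<Rightarrow> (nat \<times> nat) set \<Rightarrow> bool" where
  "linked m A B \<longleftrightarrow>
     (\<forall>i\<in>{1..m}. \<exists>p q r. (p, q) \<in> A \<and> p < i \<and> i \<le> q \<and> q \<le> r \<and> ((i, r) \<in> B \<or> r = i))"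

lemma laminarD:
  "laminar E \<Longrightarrow> (p, q) \<in> E \<Longrightarrow> (p', q') \<in> E \<Longrightarrow> p < p' \<Longrightarrow> p' \<le> q \<Longrightarrow> q' \<le> q"
  unfolding laminar_def by fastforce

lemma laminar_subset: "laminar E \<Longrightarrow> E' \<subseteq> E \<Longrightarrow> laminar E'"
  unfolding laminar_def by blast

lemma ivalsD: "(p, q) \<in> E \<Longrightarrow> E \<subseteq> ivals m \<Longrightarrow> p < q \<and> q \<le> m"
  by (auto simp: ivals_def)

lemma finite_ivals [simp]: "finite (ivals m)"
  by (rule finite_subset[of _ "{..m} \<times> {..m}"]) (auto simp: ivals_def)

section \<open>Reachability and linking\<close>

lemma reach_mono:
  assumes "A \<subseteq> A'" "B \<subseteq> B'"
  shows "reach A B \<subseteq> reach A' B'"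
proof
  fix k assume "k \<in> reach A B"
  then show "k \<in> reach A' B'"
    by induction (use assms in \<open>auto intro: reach.intros\<close>)
qed

text \<open>Let \<open>r\<close> be the right end of the longest block of \<open>B\<close> starting
  at \<open>i\<close>, or \<open>i\<close> if there is none. Without a link at \<open>i\<close> the
  set \<open>{i..r}\<close> is never entered: a move along \<open>A\<close> from below would be a
  link, and a move back along \<open>B\<close> from above would beat the choice of \<open>r\<close>
  or cross \<open>(i, r)\<close>.\<close>

lemma reach_imp_linked:
  assumes "laminar B" "A \<subseteq> ivals m" "B \<subseteq> ivals m" "{..m} \<subseteq> reach A B"
  shows "linked m A B"
  unfolding linked_def
proof
  fix i assume i: "i \<in> {1..m}"
  define r where "r = Max (insert i {r. (i, r) \<in> B})"
  have fin: "finite (insert i {r. (i, r) \<in> B})"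
    using assms(3) by (auto intro!: finite_subset[of _ "{..m}"] dest: ivalsD)
  have r: "(i, r) \<in> B \<or> r = i"
    using Max_in[OF fin] by (auto simp: r_def)
  have max: "q \<le> r" if "(i, q) \<in> B" for q
    using Max_ge[OF fin] that by (auto simp: r_def)
  have ir: "i \<le> r" using Max_ge[OF fin] by (auto simp: r_def)
  show "\<exists>p q r. (p, q) \<in> A \<and> p < i \<and> i \<le> q \<and> q \<le> r \<and> ((i, r) \<in> B \<or> r = i)"
  proof (rule ccontr)
    assume none: "\<not> ?thesis"
    have "k \<notin> {i..r}" if "k \<in> reach A B" for k
      using that
    proof induction
      case zero
      then show ?case using i by auto
    next
      case (forward p q)
      then have "p < q" using ivalsD assms(2) by blast
      show ?case
      proof
        assume "q \<in> {i..r}"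
        moreover have "p < i" using forward.IH \<open>p < q\<close> \<open>q \<in> {i..r}\<close> by auto
        ultimately show False using none r forward.hyps by auto
      qed
    next
      case (backward q p)
      show ?case
      proof
        assume p: "p \<in> {i..r}"
        have "p < q" using backward ivalsD assms(3) by blast
        then have "r < q" using backward p by auto
        then have "p \<noteq> i" using backward.hyps max by fastforce
        then have "i < p" using p by auto
        then have "(i, r) \<in> B" using r p by auto
        then show False
          using laminarD[OF assms(1) _ backward(2) \<open>i < p\<close>] p \<open>r < q\<close> by fastforce
      qed
    qed
    then show False using assms(4) i ir by fastforce
  qed
qed

text \<open>By induction on \<open>i\<close>: go from some \<open>p < i\<close> along
  \<open>A\<close> to exactly \<open>r\<close>, then back along \<open>B\<close> to
  \<open>i\<close>. The work lies in finding a block of \<open>A\<close> that ends exactly at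
  \<open>r\<close>.\<close>

lemma linked_imp_reach:
  assumes "laminar A" "laminar B" "A \<subseteq> ivals m" "B \<subseteq> ivals m" "linked m A B"
  shows "{..m} \<subseteq> reach A B"
proof
  fix i assume "i \<in> {..m}"
  then show "i \<in> reach A B"
  proof (induction i rule: less_induct)
    case (less i)
    show ?case
    proof (cases "i = 0")
      case True
      then show ?thesis by (auto intro: reach.zero)
    next
      case False
      then have "i \<in> {1..m}" using less.prems by auto
      then obtain p0 q0 r where r: "(p0, q0) \<in> A" "p0 < i" "i \<le> q0" "q0 \<le> r" "(i, r) \<in> B \<or> r = i"
        using assms(5) unfolding linked_def by blast
      define Q where "Q = {q. \<exists>p. (p, q) \<in> A \<and> p < i \<and> i \<le> q \<and> q \<le> r}"
      have fin: "finite Q" by (rule finite_subset[of _ "{..r}"]) (auto simp: Q_def)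
      have "Q \<noteq> {}" using r by (auto simp: Q_def)
      then have "Max Q \<in> Q" using fin by (rule Max_in[rotated])
      then obtain p q where pq: "(p, q) \<in> A" "p < i" "i \<le> q" "q \<le> r" "q = Max Q"
        by (auto simp: Q_def)
      have "q = r"
      proof (rule ccontr)
        assume "q \<noteq> r"
        then have qr: "q < r" using pq by simp
        then have ir: "(i, r) \<in> B" using r(5) pq by auto
        then have "r \<le> m" using assms(4) ivalsD by blast
        \<comment> \<open>If the candidate with the largest end stops short of \<open>r\<close>, the
          link at \<open>Suc q\<close> gives one that goes further: laminarity of \<open>A\<close>
          puts its start at \<open>p\<close> or below, and laminarity of \<open>B\<close> keeps its
          end within \<open>r\<close>.\<close>
        then have "Suc q \<in> {1..m}" using qr by auto
        then obtain p2 q2 r2 where 2: "(p2, q2) \<in> A" "p2 < Suc q" "Suc q \<le> q2" "q2 \<le> r2"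
          "(Suc q, r2) \<in> B \<or> r2 = Suc q"
          using assms(5) unfolding linked_def by blast
        have "p2 \<le> p" using laminarD[OF assms(1) pq(1) 2(1)] 2 by force
        moreover have "r2 \<le> r" using 2(5) qr laminarD[OF assms(2) ir, of "Suc q" r2] pq by auto
        ultimately have "q2 \<in> Q" using 2 pq by (force simp: Q_def)
        then have "q2 \<le> q" using fin pq(5) by simp
        then show False using 2 by simp
      qed
      have "p \<in> reach A B" using less.IH[OF pq(2)] less.prems pq(2) by simp
      then have "r \<in> reach A B" using pq(1) \<open>q = r\<close> by (auto intro: reach.forward)
      then show ?thesis using r(5) by (auto intro: reach.backward)
    qed
  qed
qed

text \<open>The arborescence is grown from the edge \<open>(0, m)\<close>; later edges lead to new vertices, so \<open>B\<close> never
  acquires that edge.\<close>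

lemma reach_arborescence:
  assumes "E \<subseteq> ivals m" "E' \<subseteq> ivals m" "{..m} \<subseteq> reach E E'" "(0, m) \<in> E" "0 < m"
  obtains A B where "A \<subseteq> E" "B \<subseteq> E'" "(0, m) \<in> A" "(0, m) \<notin> B" "card A + card B = m"
    "{..m} \<subseteq> reach A B"
proof -
  \<comment> \<open>\<open>T\<close> holds the \<open>j + 2\<close> indices joined so far, and
    \<open>A\<close>, \<open>B\<close> the \<open>j + 1\<close> edges used; both \<open>0\<close>
    and \<open>m\<close> are in \<open>T\<close> from the start.\<close>
  have "\<exists>T A B. T \<subseteq> {..m} \<and> card T = j + 2 \<and> 0 \<in> T \<and> m \<in> T \<and> A \<subseteq> E \<and> B \<subseteq> E' \<and>
      (0, m) \<in> A \<and> (0, m) \<notin> B \<and> card A + card B = Suc j \<and> A \<subseteq> T \<times> T \<and> B \<subseteq> T \<times> T \<and>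
      T \<subseteq> reach A B" if "j < m" for j
    using that
  proof (induction j)
    case 0
    have "0 \<in> reach {(0, m)} {}" "m \<in> reach {(0, m)} {}"
      by (auto intro: reach.intros)
    then show ?case using assms(4,5)
      by (rule_tac x="{0, m}" in exI, rule_tac x="{(0, m)}" in exI, rule_tac x="{}" in exI) auto
  next
    case (Suc j)
    then obtain T A B where T: "T \<subseteq> {..m}" "card T = j + 2" "0 \<in> T" "m \<in> T" "A \<subseteq> E" "B \<subseteq> E'"
      "(0, m) \<in> A" "(0, m) \<notin> B" "card A + card B = Suc j" "A \<subseteq> T \<times> T" "B \<subseteq> T \<times> T"
      "T \<subseteq> reach A B" by auto
    have fin: "finite T" "finite A" "finite B"
      using T(1,5,6) assms(1,2) finite_ivals finite_atMost by (meson finite_subset)+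
    \<comment> \<open>If no move led out of \<open>T\<close>, it would contain everything reachable,
      hence \<open>{..m}\<close>, which has too many elements.\<close>
    have "\<exists>p q. (p, q) \<in> E \<and> p \<in> T \<and> q \<notin> T \<or> (q, p) \<in> E' \<and> p \<in> T \<and> q \<notin> T"
    proof (rule ccontr)
      assume none: "\<not> ?thesis"
      have "k \<in> T" if "k \<in> reach E E'" for k
        using that by induction (use T(3) none in blast)+
      then have "{..m} \<subseteq> T" using assms(3) by auto
      then have "card {..m} \<le> card T" using fin by (intro card_mono)
      then show False using T Suc.prems by simp
    qed
    then obtain p q where pq: "p \<in> T" "q \<notin> T" "(p, q) \<in> E \<or> (q, p) \<in> E'" by blast
    have qm: "q \<le> m" using pq(3) ivalsD[OF _ assms(1)] ivalsD[OF _ assms(2)] by fastforce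
    have pr: "p \<in> reach A B" using T pq by auto
    from pq(3) show ?case
    proof
      assume e: "(p, q) \<in> E"
      have "q \<in> reach (insert (p, q) A) B"
        using pr reach_mono[of A "insert (p, q) A" B B]
        by (meson insertI1 order_refl reach.forward subsetD subset_insertI)
      moreover have "T \<subseteq> reach (insert (p, q) A) B"
        using T(12) reach_mono[of A "insert (p, q) A" B B] by blast
      moreover have "(p, q) \<notin> A" using T(10) pq by blast
      moreover have "card (insert q T) = Suc j + 2" using T(2) fin(1) pq(2) by simp
      moreover have "A \<subseteq> insert q T \<times> insert q T" "B \<subseteq> insert q T \<times> insert q T"
        using T(10,11) by blast+
      ultimately show ?thesis using T(1,3-9) e pq(1) qm fin
        by (rule_tac x="insert q T" in exI, rule_tac x="insert (p, q) A" in exI, rule_tac x=B in exI) simp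
    next
      assume e: "(q, p) \<in> E'"
      have "q \<in> reach A (insert (q, p) B)"
        using pr reach_mono[of A A B "insert (q, p) B"]
        by (meson insertI1 order_refl reach.backward subsetD subset_insertI)
      moreover have "T \<subseteq> reach A (insert (q, p) B)"
        using T(12) reach_mono[of A A B "insert (q, p) B"] by blast
      moreover have "(q, p) \<notin> B" using T(11) pq by blast
      moreover have "q \<noteq> 0" using T(3) pq(2) by metis
      moreover have "card (insert q T) = Suc j + 2" using T(2) fin(1) pq(2) by simp
      moreover have "A \<subseteq> insert q T \<times> insert q T" "B \<subseteq> insert q T \<times> insert q T"
        using T(10,11) by blast+
      ultimately show ?thesis using T(1,3-9) e pq(1) qm fin
        by (rule_tac x="insert q T" in exI, rule_tac x=A in exI, rule_tac x="insert (q, p) B" in exI) simp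
    qed
  qed
  from this[of "m - 1"] assms(5) obtain T A B where T: "T \<subseteq> {..m}" "card T = m + 1" "A \<subseteq> E" "B \<subseteq> E'"
    "(0, m) \<in> A" "(0, m) \<notin> B" "card A + card B = m" "T \<subseteq> reach A B" by auto
  have "T = {..m}" using T by (intro card_subset_eq) auto
  then show ?thesis using T that by auto
qed

text \<open>A laminar family is a forest: one endpoint of a shortest interval \<open>(p, q)\<close> is an
  endpoint of no other member, because two members extending \<open>(p, q)\<close> in opposite directions
  would cross.\<close>

lemma laminar_prescribed_differences:
  fixes c :: "nat \<times> nat \<Rightarrow> real"
  assumes "finite E" "laminar E" "\<And>p q. (p, q) \<in> E \<Longrightarrow> p < q"
  shows "\<exists>d. \<forall>(p, q)\<in>E. d q - d p = c (p, q)"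
  using assms
proof (induction "card E" arbitrary: E rule: less_induct)
  case less
  show ?case
  proof (cases "E = {}")
    case False
    obtain p q where pq: "(p, q) \<in> E" and min: "\<And>p' q'. (p', q') \<in> E \<Longrightarrow> q - p \<le> q' - p'"
      using ex_min_if_finite[of "(\<lambda>(p, q). q - p) ` E"] less.prems(1) False by fastforce
    define E' where "E' = E - {(p, q)}"
    have lt: "p < q" using pq less.prems by blast
    have "card E' < card E" using pq less.prems(1) unfolding E'_def by (rule card_Diff1_less[rotated])
    then obtain d where d: "\<forall>(p, q)\<in>E'. d q - d p = c (p, q)"
      using less.hyps[of E'] less.prems laminar_subset[of E E'] by (auto simp: E'_def)
    \<comment> \<open>Blocks sharing an end leaf in this way cross, so none starts at
      \<open>q\<close> and none ends at \<open>p\<close>.\<close>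
    have L: "a \<noteq> q" if "(a, b) \<in> E" for a b
      using laminarD[OF less.prems(2) pq that] less.prems(3)[OF that] lt by auto
    have R: "b \<noteq> p" if "(a, b) \<in> E" for a b
      using laminarD[OF less.prems(2) that pq] less.prems(3)[OF that] lt by auto
    show ?thesis
    proof (cases "\<exists>a. (a, q) \<in> E'")
      case False
      \<comment> \<open>Here \<open>(p, q)\<close> is the only block with endpoint \<open>q\<close>,
        so the value at \<open>q\<close> can be chosen freely.\<close>
      have "\<forall>(a, b)\<in>E. (d(q := d p + c (p, q))) b - (d(q := d p + c (p, q))) a = c (a, b)"
      proof clarify
        fix a b assume ab: "(a, b) \<in> E"
        show "(d(q := d p + c (p, q))) b - (d(q := d p + c (p, q))) a = c (a, b)"
        proof (cases "(a, b) = (p, q)")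
          case False
          then have "(a, b) \<in> E'" using ab by (simp add: E'_def)
          then show ?thesis using L[OF ab] d \<open>\<nexists>a. (a, q) \<in> E'\<close> by auto
        qed (use lt in auto)
      qed
      then show ?thesis by blast
    next
      case True
      then obtain a where a: "(a, q) \<in> E" "a \<noteq> p" by (auto simp: E'_def)
      then have "a < p" using min[OF a(1)] less.prems(3)[OF a(1)] lt by linarith
      \<comment> \<open>A block from \<open>p\<close> beyond \<open>q\<close> would cross
        \<open>(a, q)\<close>, and a shorter one is excluded by minimality; so the value at
        \<open>p\<close> can be chosen freely.\<close>
      have pb: "b = q" if "(p, b) \<in> E" for b
        using laminarD[OF less.prems(2) a(1) that \<open>a < p\<close>] lt min[OF that] by fastforce
      have "\<forall>(a, b)\<in>E. (d(p := d q - c (p, q))) b - (d(p := d q - c (p, q))) a = c (a, b)"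
      proof clarify
        fix a' b' assume ab: "(a', b') \<in> E"
        show "(d(p := d q - c (p, q))) b' - (d(p := d q - c (p, q))) a' = c (a', b')"
        proof (cases "(a', b') = (p, q)")
          case False
          then have "(a', b') \<in> E'" "a' \<noteq> p" using ab R[of p b'] pb
            by (auto simp: E'_def)
          then show ?thesis using R[OF ab] d by auto
        qed (use lt in auto)
      qed
      then show ?thesis by blast
    qed
  qed auto
qed

text \<open>For the tight blocks of an extreme point this splits a block into those of two subtrees,
  single leaves included. Take the longest proper left part \<open>(p, k)\<close>, then the longest
  block \<open>(Suc k, r)\<close> within \<open>q\<close>; if \<open>r\<close> fell short of
  \<open>q\<close>, laminarity would let no member join \<open>{Suc k..r}\<close> to its outside,
  against \<open>conn\<close>.\<close>

lemma laminar_connected_split: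
  assumes E: "laminar E" "E \<subseteq> ivals m"
    and conn: "\<And>S. S \<subseteq> {1..<m} \<Longrightarrow> S \<noteq> {} \<Longrightarrow> \<exists>(p, q)\<in>E. (p \<in> S) \<noteq> (q \<in> S)"
    and pq: "(p, q) \<in> E"
  shows "\<exists>k. p \<le> k \<and> k < q \<and> ((p, k) \<in> E \<or> k = p) \<and> ((Suc k, q) \<in> E \<or> q = Suc k)"
proof -
  have lt: "p < q" "q \<le> m" using pq E(2) ivalsD by blast+
  define k where "k = Max (insert p {k. (p, k) \<in> E \<and> k < q})"
  have fin: "finite (insert p {k. (p, k) \<in> E \<and> k < q})" by simp
  have k: "((p, k) \<in> E \<and> k < q) \<or> k = p" "p \<le> k" "\<And>k'. (p, k') \<in> E \<Longrightarrow> k' < q \<Longrightarrow> k' \<le> k"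
    using Max_in[OF fin] Max_ge[OF fin] by (auto simp: k_def)
  define r where "r = Max (insert (Suc k) {r. (Suc k, r) \<in> E \<and> r \<le> q})"
  have fin: "finite (insert (Suc k) {r. (Suc k, r) \<in> E \<and> r \<le> q})" by simp
  have r: "((Suc k, r) \<in> E \<and> r \<le> q) \<or> r = Suc k" "Suc k \<le> r"
    "\<And>r'. (Suc k, r') \<in> E \<Longrightarrow> r' \<le> q \<Longrightarrow> r' \<le> r"
    using Max_in[OF fin] Max_ge[OF fin] by (auto simp: r_def)
  have kq: "k < q" "r \<le> q" using k lt r by auto
  have "r = q"
  proof (rule ccontr)
    assume "r \<noteq> q"
    then have "{Suc k..r} \<subseteq> {1..<m}" "{Suc k..r} \<noteq> {}" using kq lt r by auto
    from conn[OF this] obtain a b where ab: "(a, b) \<in> E" "(a \<in> {Suc k..r}) \<noteq> (b \<in> {Suc k..r})"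
      by blast
    have "a < b" using ab E(2) ivalsD by blast
    consider "a \<le> k" "b \<in> {Suc k..r}" | "a \<in> {Suc k..r}" "r < b" using ab(2) \<open>a < b\<close> by fastforce
    then show False
    proof cases
      case 1
      have bq: "b < q" using 1 kq \<open>r \<noteq> q\<close> by auto
      have "p \<le> a"
      proof (rule ccontr)
        assume "\<not> p \<le> a"
        then show False using laminarD[OF E(1) ab(1) pq] 1 k bq by auto
      qed
      moreover have "a \<le> p"
      proof (rule ccontr)
        assume "\<not> a \<le> p"
        then show False using laminarD[OF E(1) _ ab(1), of p k] 1 k by auto
      qed
      ultimately show False using k(3)[of b] ab 1 bq by auto
    next
      case 2
      have "b \<le> q" using laminarD[OF E(1) pq ab(1)] 2 k kq by auto
      moreover have "a = Suc k"
      proof (rule ccontr)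
        assume "a \<noteq> Suc k"
        then show False using laminarD[OF E(1) _ ab(1), of "Suc k" r] 2 r by auto
      qed
      ultimately show False using r(3)[of b] ab 2 by auto
    qed
  qed
  then show ?thesis using k r kq by (intro exI[of _ k]) auto
qed

text \<open>\<open>top\<close> says that a set which no member of \<open>N\<close> joins to its
  outside cannot be raised: some block of \<open>E\<close> starts in it and ends outside. Without
  the claimed link \<open>{i..b}\<close> would be such a set, yet laminarity with
  \<open>(a, b)\<close> keeps every block starting in it inside. For \<open>b = m\<close> the full
  block is the link.\<close>

lemma laminar_top_link:
  assumes E: "laminar E" "E \<subseteq> ivals m" "N \<subseteq> E" "(0, m) \<in> N"
    and top: "\<And>S. S \<subseteq> {1..<m} \<Longrightarrow> S \<noteq> {} \<Longrightarrow> (\<And>p q. (p, q) \<in> N \<Longrightarrow> p \<in> S \<longleftrightarrow> q \<in> S) \<Longrightarrow>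
      \<exists>(p, q)\<in>E. p \<in> S \<and> q \<notin> S"
    and ab: "(a, b) \<in> E" "a < i" "i \<le> b"
  shows "\<exists>p q. (p, q) \<in> N \<and> p < i \<and> i \<le> q \<and> q \<le> b"
proof (rule ccontr)
  assume none: "\<not> ?thesis"
  have bm: "b < m"
  proof (rule ccontr)
    assume "\<not> b < m"
    then have "b = m" using ab ivalsD E(2) by (meson linorder_neqE_nat not_less)
    then show False using none E(4) ab by auto
  qed
  have no: "q \<in> {i..b}" if "(p, q) \<in> E" "p \<in> {i..b}" for p q
    using laminarD[OF E(1) ab(1) that(1)] that ab ivalsD[OF that(1) E(2)] by auto
  have "\<exists>(p, q)\<in>E. p \<in> {i..b} \<and> q \<notin> {i..b}"
  proof (rule top)
    show "{i..b} \<subseteq> {1..<m}" "{i..b} \<noteq> {}" using ab bm by auto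
    fix p q assume pq: "(p, q) \<in> N"
    show "p \<in> {i..b} \<longleftrightarrow> q \<in> {i..b}"
    proof
      assume "p \<in> {i..b}" then show "q \<in> {i..b}" using no pq E(3) by blast
    next
      assume q: "q \<in> {i..b}"
      have "p < q" using pq E(2,3) ivalsD by blast
      moreover have "\<not> p < i" using none pq q by auto
      ultimately show "p \<in> {i..b}" using q by auto
    qed
  qed
  then show False using no by blast
qed

text \<open>Dually, \<open>bot\<close> forbids lowering. The set used is \<open>{i..<k}\<close>,
  with \<open>k\<close> the first start after \<open>i\<close> of a block ending at
  \<open>r\<close>, or \<open>r\<close> itself. No block of \<open>E\<close> enters it from outside,
  so some member of \<open>N\<close> must leave it; laminarity and the choice of \<open>k\<close>
  force that member to start at \<open>i\<close> and to reach \<open>r\<close>.\<close>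

lemma laminar_bot_link:
  assumes E: "laminar E" "E \<subseteq> ivals m" "N \<subseteq> E"
    and bot: "\<And>S. S \<subseteq> {1..<m} \<Longrightarrow> S \<noteq> {} \<Longrightarrow> (\<And>p q. (p, q) \<in> N \<Longrightarrow> p \<in> S \<longleftrightarrow> q \<in> S) \<Longrightarrow>
      \<exists>(p, q)\<in>E. p \<notin> S \<and> q \<in> S"
    and ir: "(i, r) \<in> E" "0 < i"
  shows "\<exists>q\<ge>r. (i, q) \<in> N"
proof (rule ccontr)
  assume none: "\<not> ?thesis"
  define k where "k = (LEAST k. i < k \<and> ((k, r) \<in> E \<or> k = r))"
  have lt: "i < r" "r \<le> m" using ir E(2) ivalsD by blast+
  then have ex: "i < r \<and> ((r, r) \<in> E \<or> r = r)" by simp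
  have k: "i < k" "(k, r) \<in> E \<or> k = r" "k \<le> r"
    using LeastI[of "\<lambda>k. i < k \<and> ((k, r) \<in> E \<or> k = r)", OF ex]
      Least_le[of "\<lambda>k. i < k \<and> ((k, r) \<in> E \<or> k = r)", OF ex] by (auto simp: k_def)
  have kmin: "\<not> (i < p \<and> p < k \<and> (p, r) \<in> E)" for p
    using not_less_Least[of p "\<lambda>k. i < k \<and> ((k, r) \<in> E \<or> k = r)"] by (auto simp: k_def)
  have no: "p \<in> {i..<k}" if "(p, q) \<in> E" "q \<in> {i..<k}" for p q
  proof -
    have "p < q" using that E(2) ivalsD by blast
    moreover have "i \<le> p"
      using laminarD[OF E(1) that(1) ir(1)] that k by fastforce
    ultimately show ?thesis using that by auto
  qed
  have "\<exists>(p, q)\<in>E. p \<notin> {i..<k} \<and> q \<in> {i..<k}"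
  proof (rule bot)
    show "{i..<k} \<subseteq> {1..<m}" "{i..<k} \<noteq> {}" using ir k lt by auto
    fix p q assume pq: "(p, q) \<in> N"
    have pqE: "(p, q) \<in> E" using pq E(3) by blast
    show "p \<in> {i..<k} \<longleftrightarrow> q \<in> {i..<k}"
    proof
      assume "q \<in> {i..<k}" then show "p \<in> {i..<k}" using no pqE by blast
    next
      assume p: "p \<in> {i..<k}"
      show "q \<in> {i..<k}"
      proof (rule ccontr)
        assume "q \<notin> {i..<k}"
        then have kq: "k \<le> q" using p ivalsD[OF pqE E(2)] by auto
        have "r \<le> q"
        proof (rule ccontr)
          assume "\<not> r \<le> q"
          then show False using laminarD[OF E(1) pqE, of k r] k(2) kq p by auto
        qed
        then have "p \<noteq> i" using none pq by auto
        then have "i < p" using p by simp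
        then have "q \<le> r" using laminarD[OF E(1) ir(1) pqE] p k by auto
        then have "q = r" using \<open>r \<le> q\<close> by simp
        then show False using kmin[of p] \<open>i < p\<close> p pqE by auto
      qed
    qed
  qed
  then show False using no by blast
qed

section \<open>Partial sums as coordinates\<close>

definition pos :: "'m::{finite,linorder} \<Rightarrow> nat" where
  "pos i = card {j. j < i}"

definition coord_at :: "nat \<Rightarrow> 'm::{finite,linorder}" where
  "coord_at = inv pos"

definition psum :: "real ^ 'm::{finite,linorder} \<Rightarrow> nat \<Rightarrow> real" where
  "psum x k = (\<Sum>j<k. x $ coord_at j)"

definition of_psum :: "(nat \<Rightarrow> real) \<Rightarrow> real ^ 'm::{finite,linorder}" where
  "of_psum d = (\<chi> i. d (Suc (pos i)) - d (pos i))"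

lemma pos_strict_mono: "i < j \<Longrightarrow> pos i < pos (j :: 'm::{finite,linorder})"
  unfolding pos_def by (rule psubset_card_mono) (simp, fastforce)

lemma inj_pos: "inj (pos :: 'm::{finite,linorder} \<Rightarrow> nat)"
  by (rule injI) (metis less_irrefl neqE pos_strict_mono)

lemma pos_less: "pos (i :: 'm::{finite,linorder}) < CARD('m)"
  unfolding pos_def by (rule psubset_card_mono) auto

lemma range_pos: "range (pos :: 'm::{finite,linorder} \<Rightarrow> nat) = {..<CARD('m)}"
  by (rule card_subset_eq) (use pos_less in \<open>auto simp: card_image[OF inj_pos]\<close>)

lemma coord_at_pos [simp]: "coord_at (pos i) = i"
  by (simp add: coord_at_def inj_pos)

lemma pos_coord_at [simp]: "j < CARD('m::{finite,linorder}) \<Longrightarrow> pos (coord_at j :: 'm::{finite,linorder}) = j"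
  unfolding coord_at_def by (rule f_inv_into_f) (simp add: range_pos)

lemma bij_coord_at: "bij_betw (coord_at :: nat \<Rightarrow> 'm::{finite,linorder}) {..<CARD('m)} UNIV"
  by (rule bij_betw_byWitness[where f' = pos]) (auto simp: pos_less)

lemma psum_0 [simp]: "psum x 0 = 0"
  by (simp add: psum_def)

lemma psum_linear [simp]:
  "psum (x + y) k = psum x k + psum y k"
  "psum (x - y) k = psum x k - psum y k"
  "psum (c *\<^sub>R x) k = c * psum x k"
  "psum (- x) k = - psum x k"
  "psum 0 k = 0"
  by (simp_all add: psum_def sum.distrib sum_subtractf sum_distrib_left sum_negf)

lemma continuous_on_psum [continuous_intros]: "continuous_on S (\<lambda>x. psum x k)"
  unfolding psum_def by (intro continuous_intros)

lemma component_eq_psum: "x $ i = psum x (Suc (pos i)) - psum x (pos i)"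
  by (simp add: psum_def)

lemma psum_eqI:
  fixes x y :: "real ^ 'm::{finite,linorder}"
  assumes "\<And>k. k \<le> CARD('m) \<Longrightarrow> psum x k = psum y k"
  shows "x = y"
proof -
  have "x $ i = y $ i" for i
    using assms[of "pos i"] assms[of "Suc (pos i)"] pos_less[of i] by (simp add: component_eq_psum)
  then show ?thesis by (simp add: vec_eq_iff)
qed

lemma psum_of_psum:
  assumes "k \<le> CARD('m::{finite,linorder})"
  shows "psum (of_psum d :: real ^ 'm::{finite,linorder}) k = d k - d 0"
proof -
  have "psum (of_psum d :: real ^ 'm::{finite,linorder}) k = (\<Sum>j<k. d (Suc j) - d j)"
    unfolding psum_def of_psum_def using assms by (intro sum.cong) auto
  then show ?thesis by (simp add: sum_lessThan_telescope)
qed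

text \<open>The vector is the 0/1 indicator of the coordinates \<open>p..<q\<close>, the normal
  vector of the constraint on the block \<open>(p, q)\<close>.\<close>

lemma psum_inner:
  fixes x :: "real ^ 'm::{finite,linorder}"
  assumes "p \<le> q" "q \<le> CARD('m)"
  shows "(of_psum (\<lambda>k. real (min (max k p) q)) :: real ^ 'm::{finite,linorder}) \<bullet> x = psum x q - psum x p"
proof -
  let ?g = "of_psum (\<lambda>k. real (min (max k p) q)) :: real ^ 'm::{finite,linorder}"
  have g: "?g $ coord_at j = (if p \<le> j \<and> j < q then 1 else 0)" if "j < CARD('m)" for j
  proof -
    consider "j < p" | "p \<le> j" "j < q" | "q \<le> j" by linarith
    then show ?thesis using assms(1) that by cases (simp_all add: of_psum_def)
  qed
  have "?g \<bullet> x = (\<Sum>j<CARD('m). ?g $ coord_at j * x $ coord_at j)"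
    by (simp add: inner_vec_def sum.reindex_bij_betw[OF bij_coord_at, symmetric])
  also have "\<dots> = (\<Sum>j\<in>{p..<q}. x $ coord_at j)"
    using assms(2) by (intro sum.mono_neutral_cong_right) (auto simp: g)
  also have "\<dots> = psum x q - psum x p"
    unfolding psum_def lessThan_atLeast0 using assms by (simp add: sum_diff_nat_ivl)
  finally show ?thesis .
qed

text \<open>Summation by parts turns pairing with a decreasing vector into a combination of partial
  sums with positive coefficients.\<close>

lemma inner_decreasing:
  fixes u v :: "real ^ 'm::{finite,linorder}"
  assumes v: "\<And>i j. i < j \<Longrightarrow> v $ i > v $ j"
    and u: "\<And>k. k \<le> CARD('m) \<Longrightarrow> 0 \<le> psum u k" "psum u CARD('m) = 0"
  shows "0 \<le> u \<bullet> v" "u \<bullet> v = 0 \<Longrightarrow> u = 0"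
proof -
  define M where "M = CARD('m) - 1"
  have M: "CARD('m) = Suc M" by (simp add: M_def)
  define c where "c j = v $ coord_at j" for j
  have c: "c (Suc j) < c j" if "j < M" for j
  proof -
    have "pos (coord_at j :: 'm) < pos (coord_at (Suc j) :: 'm)" using that M by simp
    then have "(coord_at j :: 'm) < coord_at (Suc j)"
      by (metis less_asym neqE pos_strict_mono)
    then show ?thesis unfolding c_def by (rule v)
  qed
  have parts: "(\<Sum>j<k. u $ coord_at j * c j) =
      psum u k * c k + (\<Sum>j<k. psum u (Suc j) * (c j - c (Suc j)))" for k
    by (induction k) (simp_all add: psum_def algebra_simps)
  have "u \<bullet> v = (\<Sum>j<Suc M. u $ coord_at j * c j)"
    by (simp add: inner_vec_def c_def M[symmetric] sum.reindex_bij_betw[OF bij_coord_at, symmetric])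
  \<comment> \<open>The total of \<open>u\<close> is zero, which removes the boundary term and the
    last summand, the only places with the meaningless value \<open>c (Suc M)\<close>.\<close>
  also have "\<dots> = (\<Sum>j<M. psum u (Suc j) * (c j - c (Suc j)))"
    using u(2) M by (simp only: parts) simp
  finally have eq: "u \<bullet> v = (\<Sum>j<M. psum u (Suc j) * (c j - c (Suc j)))" .
  have nonneg: "0 \<le> psum u (Suc j) * (c j - c (Suc j))" if "j < M" for j
    using c[OF that] u(1)[of "Suc j"] that M by simp
  show "0 \<le> u \<bullet> v" unfolding eq using nonneg by (intro sum_nonneg) auto
  assume "u \<bullet> v = 0"
  then have z: "psum u (Suc j) * (c j - c (Suc j)) = 0" if "j < M" for j
    using eq nonneg that sum_nonneg_eq_0_iff[of "{..<M}" "\<lambda>j. psum u (Suc j) * (c j - c (Suc j))"] by auto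
  show "u = 0"
  proof (rule psum_eqI)
    fix k assume "k \<le> CARD('m)"
    then consider "k = 0" | "k = CARD('m)" | j where "k = Suc j" "j < M" using M by (cases k) force+
    then show "psum u k = psum 0 k"
      by cases (use u(2) z c in force)+
  qed
qed

text \<open>By \<open>inner_decreasing\<close> a point with pointwise largest partial sums is the
  only maximizer of the pairing with \<open>v\<close>, and a unique maximizer of a linear functional
  is extreme.\<close>

lemma top_vertex_eqI:
  fixes C :: "(real ^ 'm::{finite,linorder}) set"
  assumes v: "\<And>i j. i < j \<Longrightarrow> v $ i > v $ j"
    and x: "x \<in> C" "\<And>w k. w \<in> C \<Longrightarrow> k \<le> CARD('m) \<Longrightarrow> psum w k \<le> psum x k"
    and total: "\<And>w. w \<in> C \<Longrightarrow> psum w CARD('m) = psum x CARD('m)"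
  shows "top_vertex v C = x" "x extreme_point_of C"
proof -
  have max: "w \<bullet> v \<le> x \<bullet> v" "w \<bullet> v = x \<bullet> v \<Longrightarrow> w = x" if "w \<in> C" for w
  proof -
    have u: "0 \<le> psum (x - w) k" if "k \<le> CARD('m)" for k using x(2)[OF \<open>w \<in> C\<close> that] by simp
    have t: "psum (x - w) CARD('m) = 0" using total[OF that] by simp
    show "w \<bullet> v \<le> x \<bullet> v" using inner_decreasing(1)[OF v u t] by (simp add: inner_diff_left)
    assume "w \<bullet> v = x \<bullet> v"
    then show "w = x" using inner_decreasing(2)[OF v u t] by (simp add: inner_diff_left)
  qed
  show ex: "x extreme_point_of C"
    unfolding extreme_point_of_def
  proof (intro conjI ballI notI x(1))
    fix a b assume ab: "a \<in> C" "b \<in> C" "x \<in> open_segment a b"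
    then obtain t where t: "0 < t" "t < 1" "x = (1 - t) *\<^sub>R a + t *\<^sub>R b" "a \<noteq> b"
      by (auto simp: in_segment)
    have "x \<bullet> v = (1 - t) * (a \<bullet> v) + t * (b \<bullet> v)" by (simp add: t(3) inner_add_left)
    then have "(1 - t) * (x \<bullet> v - a \<bullet> v) + t * (x \<bullet> v - b \<bullet> v) = 0" by (simp add: algebra_simps)
    moreover have "0 \<le> (1 - t) * (x \<bullet> v - a \<bullet> v)" "0 \<le> t * (x \<bullet> v - b \<bullet> v)"
      using max(1)[OF ab(1)] max(1)[OF ab(2)] t(1,2) by simp_all
    ultimately have "(1 - t) * (x \<bullet> v - a \<bullet> v) = 0" "t * (x \<bullet> v - b \<bullet> v) = 0" by linarith+
    then have "a \<bullet> v = x \<bullet> v" "b \<bullet> v = x \<bullet> v" using t(1,2) by auto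
    then have "a = x" "b = x" using max(2)[OF ab(1)] max(2)[OF ab(2)] by simp_all
    then show False using t(4) by simp
  qed
  show "top_vertex v C = x"
    unfolding top_vertex_def
  proof (rule the_equality)
    fix y assume y: "y extreme_point_of C \<and> (\<forall>w\<in>C. w \<bullet> v \<le> y \<bullet> v)"
    then have "y \<in> C" by (simp add: extreme_point_of_def)
    then show "y = x" using max[of y] y x(1) by force
  qed (use ex max(1) in auto)
qed

lemma uminus_extreme_point_of:
  "(- x) extreme_point_of (uminus ` C) \<longleftrightarrow> x extreme_point_of (C :: 'a::real_vector set)"
proof -
  have "linear (uminus :: 'a \<Rightarrow> 'a)" "inj (uminus :: 'a \<Rightarrow> 'a)"
    by (rule linear_uminus) (rule inj_uminus)
  then have "uminus ` {x} face_of uminus ` C \<longleftrightarrow> {x} face_of C"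
    by (rule face_of_linear_image)
  then show ?thesis by (simp only: image_insert image_empty face_of_singleton)
qed


lemma bot_vertex_eqI:
  fixes C :: "(real ^ 'm::{finite,linorder}) set"
  assumes v: "\<And>i j. i < j \<Longrightarrow> v $ i > v $ j"
    and x: "x \<in> C" "\<And>w k. w \<in> C \<Longrightarrow> k \<le> CARD('m) \<Longrightarrow> psum x k \<le> psum w k"
    and total: "\<And>w. w \<in> C \<Longrightarrow> psum w CARD('m) = psum x CARD('m)"
  shows "bot_vertex v C = x" "x extreme_point_of C"
proof -
  have "(- x) extreme_point_of uminus ` C"
  proof (rule top_vertex_eqI(2)[OF v])
    fix w assume "w \<in> uminus ` C"
    then obtain w' where w: "w = - w'" "w' \<in> C" by blast
    show "psum w CARD('m) = psum (- x) CARD('m)" using total[OF w(2)] w(1) by simp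
    show "psum w k \<le> psum (- x) k" if "k \<le> CARD('m)" for k using x(2)[OF w(2) that] w(1) by simp
  qed (use x(1) in auto)
  then show ex: "x extreme_point_of C" by (simp add: uminus_extreme_point_of)
  have min: "x \<bullet> v \<le> w \<bullet> v" "w \<bullet> v = x \<bullet> v \<Longrightarrow> w = x" if "w \<in> C" for w
  proof -
    have u: "0 \<le> psum (w - x) k" if "k \<le> CARD('m)" for k using x(2)[OF \<open>w \<in> C\<close> that] by simp
    have t: "psum (w - x) CARD('m) = 0" using total[OF that] by simp
    show "x \<bullet> v \<le> w \<bullet> v" using inner_decreasing(1)[OF v u t] by (simp add: inner_diff_left)
    assume "w \<bullet> v = x \<bullet> v"
    then show "w = x" using inner_decreasing(2)[OF v u t] by (simp add: inner_diff_left)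
  qed
  show "bot_vertex v C = x"
    unfolding bot_vertex_def
  proof (rule the_equality)
    fix y assume y: "y extreme_point_of C \<and> (\<forall>w\<in>C. y \<bullet> v \<le> w \<bullet> v)"
    then have "y \<in> C" by (simp add: extreme_point_of_def)
    then show "y = x" using min[of y] y x(1) by force
  qed (use ex min(1) in auto)
qed

section \<open>Pointwise maxima and minima of partial sums\<close>

definition join :: "real ^ 'm::{finite,linorder} \<Rightarrow> real ^ 'm::{finite,linorder} \<Rightarrow> real ^ 'm::{finite,linorder}" where
  "join x y = of_psum (\<lambda>k. max (psum x k) (psum y k))"

definition meet :: "real ^ 'm::{finite,linorder} \<Rightarrow> real ^ 'm::{finite,linorder} \<Rightarrow> real ^ 'm::{finite,linorder}" where
  "meet x y = of_psum (\<lambda>k. min (psum x k) (psum y k))"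

lemma psum_join:
  "k \<le> CARD('m::{finite,linorder}) \<Longrightarrow> psum (join x (y :: real ^ 'm::{finite,linorder})) k = max (psum x k) (psum y k)"
  by (simp add: join_def psum_of_psum)

lemma psum_meet:
  "k \<le> CARD('m::{finite,linorder}) \<Longrightarrow> psum (meet x (y :: real ^ 'm::{finite,linorder})) k = min (psum x k) (psum y k)"
  by (simp add: meet_def psum_of_psum)

text \<open>Maximize the sum of all partial sums: were some \<open>w\<close> larger at one index,
  \<open>join x w\<close> would have a larger sum.\<close>

lemma compact_join_closed_has_top:
  fixes C :: "(real ^ 'm::{finite,linorder}) set"
  assumes C: "compact C" "C \<noteq> {}" and join: "\<And>x y. x \<in> C \<Longrightarrow> y \<in> C \<Longrightarrow> join x y \<in> C"
  obtains x where "x \<in> C" "\<And>w k. w \<in> C \<Longrightarrow> k \<le> CARD('m) \<Longrightarrow> psum w k \<le> psum x k"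
proof -
  have "continuous_on C (\<lambda>x. \<Sum>k\<le>CARD('m). psum x k)" by (intro continuous_intros)
  then obtain x where x: "x \<in> C" "\<And>w. w \<in> C \<Longrightarrow> (\<Sum>k\<le>CARD('m). psum w k) \<le> (\<Sum>k\<le>CARD('m). psum x k)"
    using continuous_attains_sup[OF C] by blast
  have "psum w k \<le> psum x k" if "w \<in> C" "k \<le> CARD('m)" for w k
  proof (rule ccontr)
    assume "\<not> psum w k \<le> psum x k"
    then have "(\<Sum>k\<le>CARD('m). psum x k) < (\<Sum>k\<le>CARD('m). psum (join x w) k)"
      using that(2) by (intro sum_strict_mono_ex1) (auto simp: psum_join intro!: bexI[of _ k])
    then show False using x(2)[OF join[OF x(1) that(1)]] by simp
  qed
  then show ?thesis using x(1) that by blast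
qed

lemma compact_meet_closed_has_bot:
  fixes C :: "(real ^ 'm::{finite,linorder}) set"
  assumes C: "compact C" "C \<noteq> {}" and meet: "\<And>x y. x \<in> C \<Longrightarrow> y \<in> C \<Longrightarrow> meet x y \<in> C"
  obtains x where "x \<in> C" "\<And>w k. w \<in> C \<Longrightarrow> k \<le> CARD('m) \<Longrightarrow> psum x k \<le> psum w k"
proof -
  have "join x y \<in> uminus ` C" if "x \<in> uminus ` C" "y \<in> uminus ` C" for x y
  proof -
    have "join x y = - meet (- x) (- y)"
      by (rule psum_eqI) (simp add: psum_join psum_meet)
    then show ?thesis using that meet by auto
  qed
  then obtain x where x: "x \<in> uminus ` C" "\<And>w k. w \<in> uminus ` C \<Longrightarrow> k \<le> CARD('m) \<Longrightarrow> psum w k \<le> psum x k"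
    using compact_join_closed_has_top[of "uminus ` C"] C compact_negations[OF C(1)] by auto
  show ?thesis
  proof (rule that[of "- x"])
    show "- x \<in> C" using x(1) by auto
    fix w k assume "w \<in> C" "k \<le> CARD('m)"
    then show "psum (- x) k \<le> psum w k" using x(2)[of "- w" k] by simp
  qed
qed

section \<open>The Loday polytope by inequalities\<close>

locale loday_realization =
  fixes \<omega> :: "nat list" and v :: "real ^ 'm::{finite,linorder}"
  assumes length_weight: "length \<omega> = Suc CARD('m)"
    and weight_pos: "\<forall>w\<in>set \<omega>. 0 < w"
    and v_decreasing: "\<And>i j. i < j \<Longrightarrow> v $ i > v $ j"
begin

text \<open>The half-space description of the Loday polytope, justified in
  \<open>loday_polytope_eq\<close>; \<open>ivals\<close> lists the blocks of at least two
  leaves.\<close>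

definition P :: "(real ^ 'm::{finite,linorder}) set" where
  "P = {x. psum x CARD('m) = pair_sum \<omega> 0 CARD('m) \<and>
           (\<forall>(p, q)\<in>ivals CARD('m). pair_sum \<omega> p q \<le> psum x q - psum x p)}"

definition tight :: "real ^ 'm::{finite,linorder} \<Rightarrow> (nat \<times> nat) set" where
  "tight x = {(p, q)\<in>ivals CARD('m). psum x q - psum x p = pair_sum \<omega> p q}"

definition face_set :: "(nat \<times> nat) set \<Rightarrow> (real ^ 'm::{finite,linorder}) set" where
  "face_set N = {x \<in> P. N \<subseteq> tight x}"

lemma P_total: "x \<in> P \<Longrightarrow> psum x CARD('m) = pair_sum \<omega> 0 CARD('m)"
  by (simp add: P_def)

lemma P_ge:
  assumes "x \<in> P" "p \<le> q" "q \<le> CARD('m)"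
  shows "pair_sum \<omega> p q \<le> psum x q - psum x p"
proof (cases "p = q")
  case False
  then have "(p, q) \<in> ivals CARD('m)" using assms by (auto simp: ivals_def)
  then show ?thesis using assms(1) unfolding P_def by blast
qed simp

lemma P_I:
  assumes "psum x CARD('m) = pair_sum \<omega> 0 CARD('m)"
    and "\<And>p q. p < q \<Longrightarrow> q \<le> CARD('m) \<Longrightarrow> pair_sum \<omega> p q \<le> psum x q - psum x p"
  shows "x \<in> P"
  using assms by (auto simp: P_def ivals_def)

lemma tight_subset: "tight x \<subseteq> ivals CARD('m)"
  by (auto simp: tight_def)

lemma tightD:
  assumes "(p, q) \<in> tight x"
  shows "p < q" "q \<le> CARD('m)" "psum x q - psum x p = pair_sum \<omega> p q"
  using assms by (auto simp: tight_def ivals_def)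

lemma tightI:
  "p < q \<Longrightarrow> q \<le> CARD('m) \<Longrightarrow> psum x q - psum x p = pair_sum \<omega> p q \<Longrightarrow> (p, q) \<in> tight x"
  by (auto simp: tight_def ivals_def)

lemma finite_tight [simp]: "finite (tight x)"
  by (rule finite_subset[OF tight_subset]) simp

lemma full_tight: "x \<in> P \<Longrightarrow> (0, CARD('m)) \<in> tight x"
  using P_total[of x] by (auto intro!: tightI)

text \<open>For crossing tight blocks, the constraints on \<open>p..q'\<close> and
  \<open>p'..q\<close> add up to a contradiction with the strict supermodularity in
  \<open>pair_sum_crossing\<close>.\<close>

lemma laminar_tight:
  assumes x: "x \<in> P"
  shows "laminar (tight x)"
proof -
  have False if t: "(p, q) \<in> tight x" "(p', q') \<in> tight x" and c: "p < p'" "p' \<le> q" "q < q'"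
    for p q p' q'
  proof -
    have q': "q' \<le> CARD('m)" using tightD t by blast
    have "pair_sum \<omega> p q' \<le> psum x q' - psum x p" "pair_sum \<omega> p' q \<le> psum x q - psum x p'"
      using P_ge[OF x] c q' by auto
    moreover have "psum x q - psum x p = pair_sum \<omega> p q" "psum x q' - psum x p' = pair_sum \<omega> p' q'"
      using t tightD by blast+
    moreover have "0 < (weight_sum \<omega> p' - weight_sum \<omega> p) *
        (weight_sum \<omega> (Suc q') - weight_sum \<omega> (Suc q))"
      using c q' weight_sum_strict_mono[OF _ _ weight_pos, of p p']
        weight_sum_strict_mono[OF _ _ weight_pos, of "Suc q" "Suc q'"]
      by (simp add: length_weight)
    ultimately show False using pair_sum_crossing[of p p' q q' \<omega>] c by linarith
  qed
  then show ?thesis unfolding laminar_def by blast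
qed

text \<open>Slacks are affine and nonnegative, so inside a segment a slack vanishes exactly if it
  vanishes at both ends.\<close>

lemma open_segment_tight:
  assumes "a \<in> P" "b \<in> P" "x \<in> open_segment a b"
  shows "x \<in> P" "tight x = tight a \<inter> tight b"
proof -
  obtain t where t: "0 < t" "t < 1" "x = (1 - t) *\<^sub>R a + t *\<^sub>R b"
    using assms(3) unfolding in_segment by blast
  have ps: "psum x k = (1 - t) * psum a k + t * psum b k" for k by (simp add: t(3))
  have slack: "psum x q - psum x p - pair_sum \<omega> p q =
      (1 - t) * (psum a q - psum a p - pair_sum \<omega> p q) + t * (psum b q - psum b p - pair_sum \<omega> p q)"
    for p q by (simp add: ps algebra_simps)
  have nonneg: "0 \<le> (1 - t) * (psum a q - psum a p - pair_sum \<omega> p q)"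
    "0 \<le> t * (psum b q - psum b p - pair_sum \<omega> p q)" if "p < q" "q \<le> CARD('m)" for p q
    using P_ge[OF assms(1), of p q] P_ge[OF assms(2), of p q] t(1,2) that by simp_all
  show "x \<in> P"
  proof (rule P_I)
    show "psum x CARD('m) = pair_sum \<omega> 0 CARD('m)"
      using slack[of "CARD('m)" 0] P_total[OF assms(1)] P_total[OF assms(2)] by simp
    fix p q :: nat assume "p < q" "q \<le> CARD('m)"
    then show "pair_sum \<omega> p q \<le> psum x q - psum x p" using slack[of q p] nonneg[of p q] by linarith
  qed
  have "(psum x q - psum x p = pair_sum \<omega> p q) \<longleftrightarrow>
      (psum a q - psum a p = pair_sum \<omega> p q) \<and> (psum b q - psum b p = pair_sum \<omega> p q)"
    if "p < q" "q \<le> CARD('m)" for p q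
  proof -
    have "(psum x q - psum x p = pair_sum \<omega> p q) \<longleftrightarrow>
        (1 - t) * (psum a q - psum a p - pair_sum \<omega> p q) = 0 \<and>
        t * (psum b q - psum b p - pair_sum \<omega> p q) = 0"
      using slack[of q p] nonneg[OF that] by linarith
    then show ?thesis using t(1,2) by simp
  qed
  then show "tight x = tight a \<inter> tight b" by (auto simp: tight_def ivals_def)
qed

lemma convex_P: "convex P"
  unfolding convex_contains_open_segment using open_segment_tight(1) by blast

lemma compact_P: "compact P"
proof -
  have "P = {x. psum x CARD('m) = pair_sum \<omega> 0 CARD('m)} \<inter>
      (\<Inter>(p, q)\<in>ivals CARD('m). {x. pair_sum \<omega> p q \<le> psum x q - psum x p})"
    by (auto simp: P_def)
  moreover have "closed {x :: real ^ 'm::{finite,linorder}. psum x CARD('m) = pair_sum \<omega> 0 CARD('m)}"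
    by (intro closed_Collect_eq continuous_intros)
  moreover have "closed {x :: real ^ 'm::{finite,linorder}. pair_sum \<omega> p q \<le> psum x q - psum x p}" for p q
    by (intro closed_Collect_le continuous_intros)
  ultimately have "closed P" by (auto intro!: closed_INT)
  \<comment> \<open>Constraints on two neighbouring leaves make the coordinates nonnegative, and
    their sum is fixed.\<close>
  moreover have "norm x \<le> pair_sum \<omega> 0 CARD('m)" if x: "x \<in> P" for x
  proof -
    have "0 \<le> x $ i" for i
    proof -
      have "0 \<le> pair_sum \<omega> (pos i) (Suc (pos i))"
        using pair_sum_split[of "pos i" "Suc (pos i)" "Suc (pos i)" \<omega>] by (simp add: weight_sum_mono)
      then show ?thesis
        using P_ge[OF x, of "pos i" "Suc (pos i)"] pos_less[of i] by (simp add: component_eq_psum)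
    qed
    then have "norm x \<le> (\<Sum>i\<in>UNIV. x $ i)" using norm_le_l1_cart[of x] by simp
    also have "\<dots> = psum x CARD('m)"
      by (simp add: psum_def sum.reindex_bij_betw[OF bij_coord_at, symmetric])
    finally show ?thesis using P_total[OF x] by simp
  qed
  ultimately show ?thesis by (auto simp: compact_eq_bounded_closed bounded_iff)
qed

text \<open>The finitely many slack constraints survive a small step by continuity. A tight one
  acquires the slack \<open>e * (psum d q - psum d p)\<close>, so it survives, and stays tight
  exactly if \<open>d\<close> is flat across the block.\<close>

lemma perturb:
  assumes x: "x \<in> P" and d: "psum d CARD('m) = 0" "\<And>p q. (p, q) \<in> tight x \<Longrightarrow> psum d p \<le> psum d q"
  shows "\<forall>\<^sub>F e in at_right 0. x + e *\<^sub>R d \<in> P \<and>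
    tight (x + e *\<^sub>R d) = {(p, q)\<in>tight x. psum d p = psum d q}"
proof -
  define s where "s e = (\<lambda>(p, q). psum (x + e *\<^sub>R d) q - psum (x + e *\<^sub>R d) p - pair_sum \<omega> p q)" for e
  have ev: "\<forall>\<^sub>F e in at_right 0. \<forall>I\<in>ivals CARD('m). 0 \<le> s e I \<and>
      (s e I = 0 \<longleftrightarrow> I \<in> tight x \<and> psum d (fst I) = psum d (snd I))"
  proof (rule eventually_ball_finite; (intro ballI)?)
    fix I assume I: "I \<in> ivals CARD('m)"
    obtain p q where pq: "I = (p, q)" by fastforce
    have se: "s e I = (psum x q - psum x p - pair_sum \<omega> p q) + e * (psum d q - psum d p)" for e
      by (simp add: s_def pq algebra_simps)
    show "\<forall>\<^sub>F e in at_right 0. 0 \<le> s e I \<and>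
        (s e I = 0 \<longleftrightarrow> I \<in> tight x \<and> psum d (fst I) = psum d (snd I))"
    proof (cases "I \<in> tight x")
      case True
      then have "s e I = e * (psum d q - psum d p)" for e
        using se tightD(3)[of p q x] pq by simp
      moreover have "psum d p \<le> psum d q" using True d(2) pq by simp
      ultimately have "0 \<le> s e I \<and> (s e I = 0 \<longleftrightarrow> I \<in> tight x \<and> psum d (fst I) = psum d (snd I))"
        if "0 < e" for e using True pq that by auto
      then show ?thesis by (rule eventually_mono[OF eventually_at_right_less])
    next
      case False
      then have "0 < psum x q - psum x p - pair_sum \<omega> p q"
        using I pq P_ge[OF x, of p q] tightI[of p q x] by (force simp: ivals_def)
      moreover have "((\<lambda>e. s e I) \<longlongrightarrow> (psum x q - psum x p - pair_sum \<omega> p q) + 0 * (psum d q - psum d p))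
          (at_right 0)"
        unfolding se by (intro tendsto_intros)
      ultimately have "\<forall>\<^sub>F e in at_right 0. 0 < s e I" by (auto intro: order_tendstoD)
      then show ?thesis by eventually_elim (use False in auto)
    qed
  qed simp
  then show ?thesis
  proof eventually_elim
    case (elim e)
    have "x + e *\<^sub>R d \<in> P"
    proof (rule P_I)
      show "psum (x + e *\<^sub>R d) CARD('m) = pair_sum \<omega> 0 CARD('m)" using d(1) P_total[OF x] by simp
      fix p q :: nat assume "p < q" "q \<le> CARD('m)"
      then have "0 \<le> s e (p, q)" using elim by (auto simp: ivals_def)
      then show "pair_sum \<omega> p q \<le> psum (x + e *\<^sub>R d) q - psum (x + e *\<^sub>R d) p"
        by (simp add: s_def)
    qed
    moreover have "I \<in> tight (x + e *\<^sub>R d) \<longleftrightarrow> I \<in> ivals CARD('m) \<and> s e I = 0" for I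
      unfolding tight_def s_def by (cases I) auto
    then have "I \<in> tight (x + e *\<^sub>R d) \<longleftrightarrow> I \<in> {(p, q)\<in>tight x. psum d p = psum d q}" for I
      using bspec[OF elim, of I] subsetD[OF tight_subset, of I x] by (cases I) auto
    ultimately show ?case by blast
  qed
qed

lemma perturbE:
  assumes "x \<in> P" "psum d CARD('m) = 0" "\<And>p q. (p, q) \<in> tight x \<Longrightarrow> psum d p \<le> psum d q"
  obtains e where "0 < e" "x + e *\<^sub>R d \<in> P"
    "tight (x + e *\<^sub>R d) = {(p, q)\<in>tight x. psum d p = psum d q}"
proof -
  have "\<forall>\<^sub>F e in at_right (0::real). 0 < e" by (rule eventually_at_right_less)
  moreover have "\<forall>\<^sub>F e in at_right 0. x + e *\<^sub>R d \<in> P \<and>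
      tight (x + e *\<^sub>R d) = {(p, q)\<in>tight x. psum d p = psum d q}"
    by (rule perturb) (use assms in auto)
  ultimately have "\<forall>\<^sub>F e in at_right 0. 0 < e \<and> x + e *\<^sub>R d \<in> P \<and>
      tight (x + e *\<^sub>R d) = {(p, q)\<in>tight x. psum d p = psum d q}" by eventually_elim auto
  then obtain e where "0 < e \<and> x + e *\<^sub>R d \<in> P \<and>
      tight (x + e *\<^sub>R d) = {(p, q)\<in>tight x. psum d p = psum d q}"
    using eventually_happens'[OF trivial_limit_at_right_real] by blast
  then show ?thesis using that by blast
qed

lemma join_P:
  assumes "x \<in> P" "y \<in> P"
  shows "join x y \<in> P"
proof (rule P_I)
  show "psum (join x y) CARD('m) = pair_sum \<omega> 0 CARD('m)" using assms P_total by (simp add: psum_join)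
  fix p q :: nat assume "p < q" "q \<le> CARD('m)"
  then show "pair_sum \<omega> p q \<le> psum (join x y) q - psum (join x y) p"
    using P_ge[OF assms(1), of p q] P_ge[OF assms(2), of p q] by (simp add: psum_join)
qed

lemma meet_P:
  assumes "x \<in> P" "y \<in> P"
  shows "meet x y \<in> P"
proof (rule P_I)
  show "psum (meet x y) CARD('m) = pair_sum \<omega> 0 CARD('m)" using assms P_total by (simp add: psum_meet)
  fix p q :: nat assume "p < q" "q \<le> CARD('m)"
  then show "pair_sum \<omega> p q \<le> psum (meet x y) q - psum (meet x y) p"
    using P_ge[OF assms(1), of p q] P_ge[OF assms(2), of p q] by (simp add: psum_meet)
qed

text \<open>The direction that raises the partial sums with index in \<open>S\<close>. It is applied
  to sets avoiding \<open>0\<close> and \<open>CARD('m)\<close>, where the partial sums are fixed on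
  \<open>P\<close>.\<close>

definition shift :: "nat set \<Rightarrow> real ^ 'm::{finite,linorder}" where
  "shift S = of_psum (indicator S)"

lemma psum_shift:
  assumes "S \<subseteq> {1..<CARD('m)}" "k \<le> CARD('m)"
  shows "psum (shift S) k = indicator S k"
proof -
  have "0 \<notin> S" using assms(1) by auto
  then show ?thesis using assms(2) by (simp add: shift_def psum_of_psum)
qed

lemma shift_total: "S \<subseteq> {1..<CARD('m)} \<Longrightarrow> psum (shift S) CARD('m) = 0"
  by (subst psum_shift) (auto simp: indicator_def)

text \<open>Otherwise \<open>shift S\<close> and its negative both keep all tight constraints tight,
  and \<open>x\<close> would be the midpoint of a segment in \<open>P\<close>.\<close>

lemma extreme_connected:
  assumes x: "x extreme_point_of P" and S: "S \<subseteq> {1..<CARD('m)}" "S \<noteq> {}"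
  shows "\<exists>(p, q)\<in>tight x. (p \<in> S) \<noteq> (q \<in> S)"
proof (rule ccontr)
  assume none: "\<not> ?thesis"
  have xP: "x \<in> P" using x by (simp add: extreme_point_of_def)
  have flat: "psum (shift S) p = psum (shift S) q" if "(p, q) \<in> tight x" for p q
  proof -
    have "p \<le> CARD('m)" "q \<le> CARD('m)" using tightD[OF that] by auto
    then show ?thesis using none that S(1) by (auto simp: psum_shift indicator_def)
  qed
  have "\<forall>\<^sub>F e in at_right (0::real). x + e *\<^sub>R shift S \<in> P \<and>
      tight (x + e *\<^sub>R shift S) = {(p, q)\<in>tight x. psum (shift S) p = psum (shift S) q}"
    by (rule perturb[OF xP]) (simp_all add: shift_total[OF S(1)] flat)
  moreover have "\<forall>\<^sub>F e in at_right (0::real). x + e *\<^sub>R (- shift S) \<in> P \<and>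
      tight (x + e *\<^sub>R (- shift S)) = {(p, q)\<in>tight x. psum (- shift S) p = psum (- shift S) q}"
    by (rule perturb[OF xP]) (simp_all add: shift_total[OF S(1)] flat)
  moreover have "\<forall>\<^sub>F e in at_right (0::real). 0 < e" by (rule eventually_at_right_less)
  ultimately have "\<forall>\<^sub>F e in at_right (0::real).
      0 < e \<and> x + e *\<^sub>R shift S \<in> P \<and> x + e *\<^sub>R (- shift S) \<in> P"
    by eventually_elim auto
  then obtain e where e: "0 < e" "x + e *\<^sub>R shift S \<in> P" "x + e *\<^sub>R (- shift S) \<in> P"
    using eventually_happens'[OF trivial_limit_at_right_real] by blast
  obtain k where "k \<in> S" using S(2) by auto
  then have "psum (shift S) k = 1" using S(1) by (subst psum_shift) auto
  then have "shift S \<noteq> 0" by auto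
  then have "x + e *\<^sub>R shift S \<noteq> x + e *\<^sub>R (- shift S)"
    using e(1) by (simp add: eq_neg_iff_add_eq_0 scaleR_2[symmetric])
  then have "midpoint (x + e *\<^sub>R shift S) (x + e *\<^sub>R (- shift S)) \<in>
      open_segment (x + e *\<^sub>R shift S) (x + e *\<^sub>R (- shift S))"
    by (rule midpoint_in_open_segment[THEN iffD2])
  moreover have "midpoint (x + e *\<^sub>R shift S) (x + e *\<^sub>R (- shift S)) = x"
    by (simp add: midpoint_def scaleR_2[symmetric])
  ultimately show False using x e unfolding extreme_point_of_def by metis
qed

text \<open>Each split position becomes a root: the block \<open>p..q\<close> turns into a node over
  \<open>p..k\<close> and \<open>Suc k..q\<close>, a single leaf into \<open>Leaf\<close>. The list
  in the conclusion holds the weights of the block.\<close>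

lemma tree_of_tight_splits:
  assumes split: "\<And>p q. (p, q) \<in> tight x \<Longrightarrow>
      \<exists>k. p \<le> k \<and> k < q \<and> ((p, k) \<in> tight x \<or> k = p) \<and> ((Suc k, q) \<in> tight x \<or> q = Suc k)"
  shows "(p, q) \<in> tight x \<or> p = q \<Longrightarrow> q \<le> CARD('m) \<Longrightarrow>
    \<exists>t. leaves t = Suc (q - p) \<and>
      (\<forall>j. p + j \<le> q \<longrightarrow> psum x (p + j) - psum x p = coord_sum t (take (Suc (q - p)) (drop p \<omega>)) j)"
proof (induction "q - p" arbitrary: p q rule: less_induct)
  case less
  show ?case
  proof (cases "p = q")
    case True
    then show ?thesis by (intro exI[of _ Leaf]) simp
  next
    case False
    then have pq: "(p, q) \<in> tight x" using less.prems by simp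
    from split[OF pq] obtain k where k: "p \<le> k" "k < q" "(p, k) \<in> tight x \<or> p = k"
      "(Suc k, q) \<in> tight x \<or> Suc k = q" by auto
    define S where "S = take (Suc (q - p)) (drop p \<omega>)"
    obtain a where a: "leaves a = Suc (k - p)"
      "\<And>j. p + j \<le> k \<Longrightarrow> psum x (p + j) - psum x p = coord_sum a (take (Suc (k - p)) (drop p \<omega>)) j"
    proof -
      have "k - p < q - p" "(p, k) \<in> tight x \<or> p = k" "k \<le> CARD('m)" using k less.prems(2) by auto
      from less.hyps[OF this] show ?thesis using that by blast
    qed
    obtain b where b: "leaves b = Suc (q - Suc k)"
      "\<And>j. Suc k + j \<le> q \<Longrightarrow>
        psum x (Suc k + j) - psum x (Suc k) = coord_sum b (take (Suc (q - Suc k)) (drop (Suc k) \<omega>)) j"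
    proof -
      have "q - Suc k < q - p" using k by auto
      from less.hyps[OF this k(4) less.prems(2)] show ?thesis using that by blast
    qed
    have len: "length S = leaves a + leaves b"
      using k less.prems(2) a(1) b(1) by (simp add: S_def length_weight)
    have tk: "take (leaves a) S = take (Suc (k - p)) (drop p \<omega>)"
      using k by (simp add: S_def a(1) min_def)
    have dr: "drop (leaves a) S = take (Suc (q - Suc k)) (drop (Suc k) \<omega>)"
      using k by (simp add: S_def a(1) drop_take Suc_diff_Suc)
    have W: "weight_sum S j = weight_sum \<omega> (p + j) - weight_sum \<omega> p" if "j \<le> Suc (q - p)" for j
      using that k less.prems(2)
      by (simp add: S_def weight_sum_take weight_sum_drop length_weight)
    have tight_le: "psum x q' - psum x p' = pair_sum \<omega> p' q'" if "(p', q') \<in> tight x \<or> p' = q'" for p' q'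
      using that tightD(3) by auto
    have la: "p + leaves a = Suc k" "p + (leaves a + leaves b) = Suc q"
      using k a(1) b(1) by auto
    \<comment> \<open>Subtracting the two tight parts from the tight whole leaves the pairs
      separated at \<open>Suc k\<close>, which form the Loday product of the root.\<close>
    have root: "psum x (Suc k) - psum x k =
        weight_sum S (leaves a) * (weight_sum S (leaves a + leaves b) - weight_sum S (leaves a))"
      using tight_le[OF k(3)] tight_le[OF k(4)] tight_le[of p q] pq
        pair_sum_split[of p "Suc k" q \<omega>] k a(1) b(1)
      by (simp add: W la)
    have "psum x (p + j) - psum x p = coord_sum (Node a b) S j" if "p + j \<le> q" for j
    proof (cases "j < leaves a")
      case True
      then have "p + j \<le> k" using a(1) k by simp
      then show ?thesis using a(2) True by (simp add: coord_sum_Node_left[OF len] tk)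
    next
      case False
      then obtain i where i: "j = leaves a + i" by (metis le_Suc_ex not_less)
      have ik: "Suc k + i \<le> q" "i < leaves b" using i that a(1) b(1) k by auto
      have "psum x (p + (k - p)) - psum x p = coord_sum a (take (leaves a) S) (leaves a - 1)"
        using a(2)[of "k - p"] a(1) k tk by simp
      moreover have "psum x (p + j) - psum x (Suc k) = coord_sum b (drop (leaves a) S) i"
        using b(2)[OF ik(1)] i la by (simp add: dr add.assoc[symmetric])
      ultimately show ?thesis
        using root k coord_sum_Node_right[OF len ik(2)] by (simp add: i)
    qed
    then show ?thesis using a(1) b(1) k unfolding S_def by (intro exI[of _ "Node a b"]) auto
  qed
qed

lemma psum_loday_vertex:
  assumes "k \<le> CARD('m)"
  shows "psum (loday_vertex t \<omega> :: real ^ 'm::{finite,linorder}) k = coord_sum t \<omega> k"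
  unfolding psum_def coord_sum_def loday_vertex_def using assms
  by (intro sum.cong) (auto simp flip: pos_def)

lemma loday_vertex_in_P:
  assumes "t \<in> PBT (length \<omega>)"
  shows "loday_vertex t \<omega> \<in> P"
proof (rule P_I)
  have t: "length \<omega> = leaves t" "leaves t = Suc CARD('m)" using assms length_weight by (simp_all add: PBT_def)
  show "psum (loday_vertex t \<omega> :: real ^ 'm::{finite,linorder}) CARD('m) = pair_sum \<omega> 0 CARD('m)"
    using coord_sum_total[OF t(1)] t(2) by (simp add: psum_loday_vertex)
  fix p q :: nat assume "p < q" "q \<le> CARD('m)"
  then show "pair_sum \<omega> p q \<le> psum (loday_vertex t \<omega> :: real ^ 'm::{finite,linorder}) q - psum (loday_vertex t \<omega> :: real ^ 'm::{finite,linorder}) p"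
    using coord_sum_ge[OF t(1), of p q] t(2) by (simp add: psum_loday_vertex)
qed

lemma extreme_point_is_loday_vertex:
  assumes x: "x extreme_point_of P"
  obtains t where "t \<in> PBT (length \<omega>)" "x = loday_vertex t \<omega>"
proof -
  have xP: "x \<in> P" using x by (simp add: extreme_point_of_def)
  have "\<exists>k. p \<le> k \<and> k < q \<and> ((p, k) \<in> tight x \<or> k = p) \<and> ((Suc k, q) \<in> tight x \<or> q = Suc k)"
    if "(p, q) \<in> tight x" for p q
    using laminar_connected_split[OF laminar_tight[OF xP] tight_subset _ that] extreme_connected[OF x]
    by blast
  from tree_of_tight_splits[OF this, of 0 "CARD('m)"] obtain t where t: "leaves t = Suc CARD('m)"
    "\<And>j. j \<le> CARD('m) \<Longrightarrow> psum x j = coord_sum t \<omega> j"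
    using full_tight[OF xP] length_weight by auto
  have "x = loday_vertex t \<omega>" by (rule psum_eqI) (simp add: t(2) psum_loday_vertex)
  then show ?thesis using that[of t] t(1) length_weight by (simp add: PBT_def)
qed

text \<open>\<open>P\<close> is convex and contains the Loday vertices; conversely, being compact,
  it is the hull of its extreme points, which are Loday vertices.\<close>

lemma loday_polytope_eq: "loday_polytope \<omega> = P"
proof
  show "loday_polytope \<omega> \<subseteq> P"
    unfolding loday_polytope_def by (rule hull_minimal) (auto simp: loday_vertex_in_P convex_P)
  have "{x. x extreme_point_of P} \<subseteq> (\<lambda>t. loday_vertex t \<omega>) ` PBT (length \<omega>)"
    by (auto elim: extreme_point_is_loday_vertex)
  then have "convex hull {x. x extreme_point_of P} \<subseteq> loday_polytope \<omega>"
    unfolding loday_polytope_def by (rule hull_mono)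
  then show "P \<subseteq> loday_polytope \<omega>"
    by (rule ord_eq_le_trans[OF Krein_Milman_Minkowski[OF compact_P convex_P]])
qed

section \<open>Faces and the diagonal\<close>

lemma face_setD:
  assumes "x \<in> face_set N"
  shows "x \<in> P" "N \<subseteq> tight x"
  using assms by (auto simp: face_set_def)

lemma face_of_face_set: "face_set N face_of P"
  unfolding face_of_def
proof (intro conjI ballI impI)
  show "face_set N \<subseteq> P" by (auto simp: face_set_def)
  show "convex (face_set N)"
    unfolding convex_contains_open_segment
  proof (intro ballI subsetI)
    fix a b x assume "a \<in> face_set N" "b \<in> face_set N" "x \<in> open_segment a b"
    then show "x \<in> face_set N" using open_segment_tight[of a b x] by (auto simp: face_set_def)
  qed
next
  fix a b x assume "a \<in> P" "b \<in> P" "x \<in> face_set N" "x \<in> open_segment a b"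
  then show "a \<in> face_set N" "b \<in> face_set N"
    using open_segment_tight[of a b x] by (auto simp: face_set_def)
qed

text \<open>A point of \<open>F\<close> with the fewest tight constraints plays the role of a relative interior
  point.\<close>

lemma face_eq_face_set:
  assumes F: "F face_of P" "F \<noteq> {}"
  obtains x where "x \<in> F" "F = face_set (tight x)"
proof -
  obtain x where x: "x \<in> F" and min: "\<And>y. y \<in> F \<Longrightarrow> card (tight x) \<le> card (tight y)"
    using F(2) ex_has_least_nat[of "\<lambda>x. x \<in> F" _ "\<lambda>x. card (tight x)"] by blast
  have FP: "F \<subseteq> P" using F(1) by (rule face_of_imp_subset)
  have "tight x \<subseteq> tight w" if w: "w \<in> F" for w
  proof (cases "w = x")
    case False
    then have mid: "midpoint x w \<in> open_segment x w" by simp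
    then have "midpoint x w \<in> F"
      using face_of_imp_convex[OF F(1)] x w unfolding convex_contains_open_segment by blast
    \<comment> \<open>The intersection is the tight set of the midpoint, so the minimality of
      \<open>x\<close> applies to it.\<close>
    then have "card (tight x) \<le> card (tight x \<inter> tight w)"
      using min open_segment_tight(2)[OF _ _ mid] x w FP by fastforce
    then have "tight x \<inter> tight w = tight x" by (intro card_seteq) auto
    then show ?thesis by blast
  qed simp
  moreover have "w \<in> F" if w: "w \<in> P" "tight x \<subseteq> tight w" for w
  proof (cases "w = x")
    case False
    have xP: "x \<in> P" using x FP by blast
    have flat: "psum (x - w) p = psum (x - w) q" if "(p, q) \<in> tight x" for p q
      using tightD(3)[OF that] tightD(3)[of p q w] w(2) that by fastforce
    have "psum (x - w) CARD('m) = 0" using P_total[OF xP] P_total[OF w(1)] by simp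
    \<comment> \<open>All constraints tight at \<open>x\<close> are tight at \<open>w\<close>, so
      the segment from \<open>w\<close> to \<open>x\<close> can be prolonged past \<open>x\<close>
      inside \<open>P\<close>. Then \<open>x\<close>, at parameter \<open>1 / (1 + e)\<close>, is
      interior to it, and the face property yields \<open>w \<in> F\<close>.\<close>
    then obtain e where e: "0 < e" "x + e *\<^sub>R (x - w) \<in> P"
      using perturbE[OF xP, of "x - w"] flat by (metis order_refl)
    have "x \<in> open_segment w (x + e *\<^sub>R (x - w))"
      unfolding in_segment
    proof (intro conjI exI[of _ "1 / (1 + e)"])
      have "x + e *\<^sub>R (x - w) - w = (1 + e) *\<^sub>R (x - w)" by (simp add: algebra_simps)
      moreover have "(1 + e) *\<^sub>R (x - w) \<noteq> 0" using e(1) False by simp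
      ultimately show "w \<noteq> x + e *\<^sub>R (x - w)" by fastforce
      have "(1 - 1 / (1 + e)) *\<^sub>R w + (1 / (1 + e)) *\<^sub>R (x + e *\<^sub>R (x - w)) =
          (1 - 1 / (1 + e) - e / (1 + e)) *\<^sub>R w + (1 / (1 + e) + e / (1 + e)) *\<^sub>R x"
        by (simp add: algebra_simps)
      also have "\<dots> = x"
      proof -
        have "1 / (1 + e) + e / (1 + e) = 1"
          using e(1) by (simp add: add_divide_distrib[symmetric])
        then have "1 - 1 / (1 + e) - e / (1 + e) = 0" by linarith
        with \<open>1 / (1 + e) + e / (1 + e) = 1\<close> show ?thesis by (simp only:) simp
      qed
      finally show "x = (1 - 1 / (1 + e)) *\<^sub>R w + (1 / (1 + e)) *\<^sub>R (x + e *\<^sub>R (x - w))" by simp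
    qed (use e(1) in auto)
    then show ?thesis using face_ofD[OF F(1) _ w(1) e(2) x] by blast
  qed (use x in simp)
  ultimately have "F = face_set (tight x)" using FP by (auto simp: face_set_def)
  then show ?thesis using x that by blast
qed

lemma face_set_join:
  assumes "x \<in> face_set N" "y \<in> face_set N"
  shows "join x y \<in> face_set N"
proof -
  have "(p, q) \<in> tight (join x y)" if "(p, q) \<in> N" for p q
  proof -
    have t: "(p, q) \<in> tight x" "(p, q) \<in> tight y" using assms that face_setD(2) by blast+
    then show ?thesis using tightD[OF t(1)] tightD(3)[OF t(2)]
      by (intro tightI) (auto simp: psum_join max_def)
  qed
  then show ?thesis using assms join_P by (auto simp: face_set_def)
qed

lemma face_set_meet:
  assumes "x \<in> face_set N" "y \<in> face_set N"
  shows "meet x y \<in> face_set N"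
proof -
  have "(p, q) \<in> tight (meet x y)" if "(p, q) \<in> N" for p q
  proof -
    have t: "(p, q) \<in> tight x" "(p, q) \<in> tight y" using assms that face_setD(2) by blast+
    then show ?thesis using tightD[OF t(1)] tightD(3)[OF t(2)]
      by (intro tightI) (auto simp: psum_meet min_def)
  qed
  then show ?thesis using assms meet_P by (auto simp: face_set_def)
qed

lemma compact_face_set: "compact (face_set N)"
  using face_of_imp_compact[OF convex_P compact_P face_of_face_set] .

section \<open>Tops and bottoms of faces and the Tamari order\<close>

definition is_top :: "(nat \<times> nat) set \<Rightarrow> real ^ 'm::{finite,linorder} \<Rightarrow> bool" where
  "is_top N x \<longleftrightarrow> x \<in> face_set N \<and> (\<forall>w\<in>face_set N. \<forall>k\<le>CARD('m). psum w k \<le> psum x k)"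

definition is_bot :: "(nat \<times> nat) set \<Rightarrow> real ^ 'm::{finite,linorder} \<Rightarrow> bool" where
  "is_bot N x \<longleftrightarrow> x \<in> face_set N \<and> (\<forall>w\<in>face_set N. \<forall>k\<le>CARD('m). psum x k \<le> psum w k)"

text \<open>The face is compact and closed under \<open>join\<close>, so a pointwise maximum exists;
  it is extreme in the face, hence in \<open>P\<close>, hence given by a tree.\<close>

lemma face_set_top:
  assumes "face_set N \<noteq> {}"
  obtains s where "s \<in> PBT (length \<omega>)" "is_top N (loday_vertex s \<omega>)"
    "top_vertex v (face_set N) = loday_vertex s \<omega>"
proof -
  obtain x where x: "x \<in> face_set N"
    "\<And>w k. w \<in> face_set N \<Longrightarrow> k \<le> CARD('m) \<Longrightarrow> psum w k \<le> psum x k"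
    using compact_join_closed_has_top[OF compact_face_set assms face_set_join] by blast
  have total: "psum w CARD('m) = psum x CARD('m)" if "w \<in> face_set N" for w
    using P_total[of w] P_total[of x] face_setD(1)[OF that] face_setD(1)[OF x(1)] by simp
  have "x extreme_point_of face_set N"
    by (rule top_vertex_eqI(2)[OF v_decreasing x total])
  then have "x extreme_point_of P"
    by (simp add: extreme_point_of_face[OF face_of_face_set])
  then obtain s where "s \<in> PBT (length \<omega>)" "x = loday_vertex s \<omega>"
    by (rule extreme_point_is_loday_vertex)
  moreover have "top_vertex v (face_set N) = x"
    by (rule top_vertex_eqI(1)[OF v_decreasing x total])
  moreover have "is_top N x" using x by (simp add: is_top_def)
  ultimately show ?thesis using that by blast
qed

lemma face_set_bot:
  assumes "face_set N \<noteq> {}"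
  obtains s where "s \<in> PBT (length \<omega>)" "is_bot N (loday_vertex s \<omega>)"
    "bot_vertex v (face_set N) = loday_vertex s \<omega>"
proof -
  obtain x where x: "x \<in> face_set N"
    "\<And>w k. w \<in> face_set N \<Longrightarrow> k \<le> CARD('m) \<Longrightarrow> psum x k \<le> psum w k"
    using compact_meet_closed_has_bot[OF compact_face_set assms face_set_meet] by blast
  have total: "psum w CARD('m) = psum x CARD('m)" if "w \<in> face_set N" for w
    using P_total[of w] P_total[of x] face_setD(1)[OF that] face_setD(1)[OF x(1)] by simp
  have "x extreme_point_of face_set N"
    by (rule bot_vertex_eqI(2)[OF v_decreasing x total])
  then have "x extreme_point_of P"
    by (simp add: extreme_point_of_face[OF face_of_face_set])
  then obtain s where "s \<in> PBT (length \<omega>)" "x = loday_vertex s \<omega>"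
    by (rule extreme_point_is_loday_vertex)
  moreover have "bot_vertex v (face_set N) = x"
    by (rule bot_vertex_eqI(1)[OF v_decreasing x total])
  moreover have "is_bot N x" using x by (simp add: is_bot_def)
  ultimately show ?thesis using that by blast
qed

text \<open>If no tight block started in \<open>S\<close> and ended outside, raising the partial
  sums on \<open>S\<close> would stay in the face and beat its pointwise maximum. This supplies the
  hypothesis of \<open>laminar_top_link\<close>.\<close>

lemma is_top_link:
  assumes top: "is_top N x" and full: "(0, CARD('m)) \<in> N"
    and ab: "(a, b) \<in> tight x" "a < i" "i \<le> b"
  shows "\<exists>p q. (p, q) \<in> N \<and> p < i \<and> i \<le> q \<and> q \<le> b"
proof (rule laminar_top_link[OF laminar_tight tight_subset _ full _ ab])
  have x: "x \<in> face_set N" using top by (simp add: is_top_def)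
  show xP: "x \<in> P" and N: "N \<subseteq> tight x" using face_setD[OF x] by auto
  fix S assume S: "S \<subseteq> {1..<CARD('m)}" "S \<noteq> {}" and flat: "\<And>p q. (p, q) \<in> N \<Longrightarrow> p \<in> S \<longleftrightarrow> q \<in> S"
  show "\<exists>(p, q)\<in>tight x. p \<in> S \<and> q \<notin> S"
  proof (rule ccontr)
    assume none: "\<not> ?thesis"
    have d: "psum (shift S) p = indicator S p" "psum (shift S) q = indicator S q"
      if "(p, q) \<in> tight x" for p q
      using tightD[OF that] by (simp_all add: psum_shift[OF S(1)])
    have "psum (shift S) p \<le> psum (shift S) q" if "(p, q) \<in> tight x" for p q
      using none that by (auto simp: d[OF that] indicator_def)
    from perturbE[OF xP shift_total[OF S(1)] this] obtain e where e: "0 < e"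
      "x + e *\<^sub>R shift S \<in> P"
      "tight (x + e *\<^sub>R shift S) = {(p, q)\<in>tight x. psum (shift S) p = psum (shift S) q}" by blast
    have "N \<subseteq> tight (x + e *\<^sub>R shift S)"
      unfolding e(3) using N flat d by (fastforce simp: indicator_def)
    then have "x + e *\<^sub>R shift S \<in> face_set N" using e(2) by (simp add: face_set_def)
    moreover obtain k where k: "k \<in> S" using S(2) by blast
    moreover have "k \<le> CARD('m)" using k S(1) by auto
    ultimately have "psum (x + e *\<^sub>R shift S) k \<le> psum x k" using top by (auto simp: is_top_def)
    then show False using e(1) k \<open>k \<le> CARD('m)\<close> by (simp add: psum_shift[OF S(1)])
  qed
qed

text \<open>The same argument with \<open>- shift S\<close>, which is blocked by tight blocks that
  start outside \<open>S\<close> and end in it.\<close>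

lemma is_bot_link:
  assumes bot: "is_bot N x" and ir: "(i, r) \<in> tight x" "0 < i"
  shows "\<exists>q\<ge>r. (i, q) \<in> N"
proof (rule laminar_bot_link[OF laminar_tight tight_subset _ _ ir])
  have x: "x \<in> face_set N" using bot by (simp add: is_bot_def)
  show xP: "x \<in> P" and N: "N \<subseteq> tight x" using face_setD[OF x] by auto
  fix S assume S: "S \<subseteq> {1..<CARD('m)}" "S \<noteq> {}" and flat: "\<And>p q. (p, q) \<in> N \<Longrightarrow> p \<in> S \<longleftrightarrow> q \<in> S"
  show "\<exists>(p, q)\<in>tight x. p \<notin> S \<and> q \<in> S"
  proof (rule ccontr)
    assume none: "\<not> ?thesis"
    have d: "psum (- shift S) p = - indicator S p" "psum (- shift S) q = - indicator S q"
      if "(p, q) \<in> tight x" for p q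
      using tightD[OF that] by (simp_all add: psum_shift[OF S(1)])
    have "psum (- shift S) p \<le> psum (- shift S) q" if "(p, q) \<in> tight x" for p q
      using none that unfolding d[OF that] by (auto simp: indicator_def)
    moreover have "psum (- shift S) CARD('m) = 0" by (simp add: shift_total[OF S(1)])
    ultimately obtain e where e: "0 < e" "x + e *\<^sub>R (- shift S) \<in> P"
      "tight (x + e *\<^sub>R (- shift S)) = {(p, q)\<in>tight x. psum (- shift S) p = psum (- shift S) q}"
      using perturbE[OF xP, of "- shift S"] by blast
    have "N \<subseteq> tight (x + e *\<^sub>R (- shift S))"
      unfolding e(3) using N flat d by (fastforce simp: indicator_def)
    then have "x + e *\<^sub>R (- shift S) \<in> face_set N" using e(2) by (simp add: face_set_def)
    moreover obtain k where k: "k \<in> S" using S(2) by blast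
    moreover have "k \<le> CARD('m)" using k S(1) by auto
    ultimately have "psum x k \<le> psum (x + e *\<^sub>R (- shift S)) k" using bot by (auto simp: is_bot_def)
    then show False using e(1) k \<open>k \<le> CARD('m)\<close> by (simp add: psum_shift[OF S(1)])
  qed
qed

lemma right_extent_tight:
  assumes s: "s \<in> PBT (length \<omega>)" and i: "0 < i" "i \<le> CARD('m)"
  shows "i \<le> right_extent s i" "right_extent s i \<le> CARD('m)"
    "right_extent s i = i \<or> (i, right_extent s i) \<in> tight (loday_vertex s \<omega>)"
    "\<exists>a<i. (a, right_extent s i) \<in> tight (loday_vertex s \<omega>)"
proof -
  have len: "length \<omega> = leaves s" "leaves s = Suc CARD('m)"
    using s length_weight by (simp_all add: PBT_def)
  show ge: "i \<le> right_extent s i" using i(2) len by (intro right_extent_ge) simp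
  show le: "right_extent s i \<le> CARD('m)" using right_extent_less[of s i] len by simp
  have "i < leaves s" using i len by simp
  from coord_sum_right_extent[OF len(1) i(1) this] obtain a where a: "a < i"
    "coord_sum s \<omega> (right_extent s i) - coord_sum s \<omega> i = pair_sum \<omega> i (right_extent s i)"
    "coord_sum s \<omega> (right_extent s i) - coord_sum s \<omega> a = pair_sum \<omega> a (right_extent s i)"
    by blast
  show "right_extent s i = i \<or> (i, right_extent s i) \<in> tight (loday_vertex s \<omega>)"
    using a(2) ge le i by (auto intro!: tightI simp: psum_loday_vertex)
  show "\<exists>a<i. (a, right_extent s i) \<in> tight (loday_vertex s \<omega>)"
    using a(1,3) ge le i by (intro exI[of _ a]) (auto intro!: tightI simp: psum_loday_vertex)
qed

text \<open>Vertex \<open>i\<close> of \<open>s\<close> gives, by \<open>is_top_link\<close>, a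
  member of \<open>A\<close> around \<open>i\<close> ending no later than its extent. The right
  input of vertex \<open>i\<close> in \<open>t\<close>, unless a single leaf, gives by
  \<open>is_bot_link\<close> a member of \<open>B\<close> from \<open>i\<close> ending no earlier
  than its extent. The comparison of extents joins the two.\<close>

lemma tamari_le_imp_linked:
  assumes s: "s \<in> PBT (length \<omega>)" "is_top A (loday_vertex s \<omega>)"
    and t: "t \<in> PBT (length \<omega>)" "is_bot B (loday_vertex t \<omega>)"
    and le: "tamari_le s t" and full: "(0, CARD('m)) \<in> A"
  shows "linked CARD('m) A B"
  unfolding linked_def
proof
  fix i assume "i \<in> {1..CARD('m)}"
  then have i: "0 < i" "i \<le> CARD('m)" by auto
  obtain a where a: "a < i" "(a, right_extent s i) \<in> tight (loday_vertex s \<omega>)"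
    using right_extent_tight(4)[OF s(1) i] by blast
  obtain p q where pq: "(p, q) \<in> A" "p < i" "i \<le> q" "q \<le> right_extent s i"
    using is_top_link[OF s(2) full a(2,1) right_extent_tight(1)[OF s(1) i]] by blast
  have "q \<le> right_extent t i" using pq(4) tamari_le_right_extent[OF le, of i] by simp
  moreover have "right_extent t i = i \<or> (\<exists>r\<ge>right_extent t i. (i, r) \<in> B)"
    using right_extent_tight(3)[OF t(1) i] is_bot_link[OF t(2) _ i(1)] by blast
  ultimately show "\<exists>p q r. (p, q) \<in> A \<and> p < i \<and> i \<le> q \<and> q \<le> r \<and> ((i, r) \<in> B \<or> r = i)"
    using pq by (metis order_trans)
qed

text \<open>\<open>A\<close> and \<open>B\<close> are tight at all points of their faces, so
  laminarity bounds the extents: that of \<open>i\<close> in \<open>s\<close> cannot pass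
  \<open>q\<close>, and that in \<open>t\<close> cannot fall short of \<open>r\<close>.\<close>

lemma linked_imp_tamari_le:
  assumes s: "s \<in> PBT (length \<omega>)" "loday_vertex s \<omega> \<in> face_set A"
    and t: "t \<in> PBT (length \<omega>)" "loday_vertex t \<omega> \<in> face_set B"
    and linked: "linked CARD('m) A B"
  shows "tamari_le s t"
proof (rule right_extent_imp_tamari_le)
  show "leaves s = leaves t" using s(1) t(1) by (simp add: PBT_def)
  fix i assume i: "0 < i" "i < leaves t"
  then have im: "i \<le> CARD('m)" using t(1) length_weight by (simp add: PBT_def)
  then have "i \<in> {1..CARD('m)}" using i by simp
  then obtain p q r where pq: "(p, q) \<in> A" "p < i" "i \<le> q" "q \<le> r" "(i, r) \<in> B \<or> r = i"
    using linked unfolding linked_def by blast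
  have lam: "laminar (tight (loday_vertex s \<omega>))" "laminar (tight (loday_vertex t \<omega>))"
    using laminar_tight face_setD(1) s(2) t(2) by blast+
  have sub: "A \<subseteq> tight (loday_vertex s \<omega>)" "B \<subseteq> tight (loday_vertex t \<omega>)"
    using face_setD(2) s(2) t(2) by blast+
  have "right_extent s i \<le> q"
    using right_extent_tight(3)[OF s(1) i(1) im] pq
      laminarD[OF lam(1), of p q i "right_extent s i"] sub(1) by auto
  moreover have "r \<le> right_extent t i"
    using right_extent_tight(1,4)[OF t(1) i(1) im] pq(5) sub(2)
      laminarD[OF lam(2), of _ "right_extent t i" i r] by auto
  ultimately show "right_extent s i \<le> right_extent t i" using pq(4) by simp
qed

section \<open>Reachability and the image of the diagonal\<close>

lemma reach_lower_bound:
  assumes "w \<in> P" "x + y - w \<in> P" "k \<in> reach (tight x) (tight y)"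
  shows "psum x k \<le> psum w k"
  using assms(3)
\<comment> \<open>Across a block tight at \<open>x\<close> the constraint on \<open>w\<close> makes
  \<open>w\<close> grow at least as much as \<open>x\<close>. Across a block tight at
  \<open>y\<close> the constraint on \<open>x + y - w\<close> makes \<open>w\<close> grow at most as
  much as \<open>x\<close>, so the inequality passes from \<open>q\<close> back to
  \<open>p\<close>.\<close>
proof induction
  case (forward p q)
  have "pair_sum \<omega> p q \<le> psum w q - psum w p"
    using P_ge[OF assms(1), of p q] tightD[OF forward(2)] by simp
  then show ?case using forward.IH tightD(3)[OF forward(2)] by linarith
next
  case (backward q p)
  have "pair_sum \<omega> p q \<le> psum (x + y - w) q - psum (x + y - w) p"
    using P_ge[OF assms(2), of p q] tightD[OF backward(2)] by simp
  then show ?case using backward.IH tightD(3)[OF backward(2)] by simp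
qed simp

text \<open>The intersection consists of the \<open>w\<close> with \<open>w\<close> and
  \<open>x + y - w\<close> in \<open>P\<close>. By \<open>reach_lower_bound\<close>,
  \<open>x\<close> is its pointwise minimum, and the symmetry \<open>w \<mapsto> x + y - w\<close>
  makes \<open>y\<close> its maximum.\<close>

lemma diagonal_of_reach:
  assumes xy: "x \<in> P" "y \<in> P" and reach: "{..CARD('m)} \<subseteq> reach (tight x) (tight y)"
  shows "diagonal v P (midpoint x y) = (x, y)"
proof -
  define C where "C = P \<inter> point_reflection (midpoint x y) P"
  have two: "2 *\<^sub>R midpoint x y = x + y" by (simp add: midpoint_def)
  have C: "w \<in> C \<longleftrightarrow> w \<in> P \<and> x + y - w \<in> P" for w
  proof -
    have "w \<in> point_reflection (midpoint x y) P \<longleftrightarrow> x + y - w \<in> P"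
      unfolding point_reflection_def two image_iff
      by (auto intro: bexI[of _ "x + y - w"])
    then show ?thesis by (simp add: C_def)
  qed
  have total: "psum w CARD('m) = pair_sum \<omega> 0 CARD('m)" if "w \<in> C" for w
    using that C P_total by blast
  have xC: "x \<in> C" "y \<in> C" using xy C by auto
  have lower: "psum x k \<le> psum w k" if "w \<in> C" "k \<le> CARD('m)" for w k
    using reach_lower_bound[of w x y k] that C reach by auto
  have upper: "psum w k \<le> psum y k" if "w \<in> C" "k \<le> CARD('m)" for w k
    using lower[of "x + y - w" k] that C by simp
  have "bot_vertex v C = x"
    by (rule bot_vertex_eqI(1)[OF v_decreasing xC(1) lower]) (simp_all add: total xC(1))
  moreover have "top_vertex v C = y"
    by (rule top_vertex_eqI(1)[OF v_decreasing xC(2) upper]) (simp_all add: total xC(2))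
  ultimately show ?thesis by (simp add: diagonal_def C_def)
qed

text \<open>Take for \<open>x\<close> the pointwise minimum of the intersection and for
  \<open>y\<close> its reflection. If some indices were unreached, \<open>x\<close> could be lowered
  and \<open>y\<close> raised on all of them at once with the same midpoint, against
  minimality.\<close>

lemma reach_of_diagonal:
  assumes z: "z \<in> P"
  obtains x y where "x \<in> P" "y \<in> P" "z = midpoint x y" "{..CARD('m)} \<subseteq> reach (tight x) (tight y)"
proof -
  define C where "C = P \<inter> (\<lambda>w. 2 *\<^sub>R z - w) ` P"
  have C: "w \<in> C \<longleftrightarrow> w \<in> P \<and> 2 *\<^sub>R z - w \<in> P" for w
  proof -
    have "w = 2 *\<^sub>R z - (2 *\<^sub>R z - w)" by simp
    then have "2 *\<^sub>R z - w \<in> P \<Longrightarrow> w \<in> (\<lambda>w. 2 *\<^sub>R z - w) ` P" by (rule image_eqI)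
    then show ?thesis by (auto simp: C_def)
  qed
  have "compact C"
    unfolding C_def
    by (intro compact_Int compact_P compact_continuous_image continuous_intros)
  moreover have "2 *\<^sub>R z - z = z" by (simp add: scaleR_2)
  then have "z \<in> C" using z C by simp
  then have "C \<noteq> {}" by blast
  moreover have "meet a b \<in> C" if "a \<in> C" "b \<in> C" for a b
  proof -
    have "2 *\<^sub>R z - meet a b = join (2 *\<^sub>R z - a) (2 *\<^sub>R z - b)"
      by (rule psum_eqI) (simp add: psum_join psum_meet)
    then show ?thesis using that C meet_P join_P by simp
  qed
  ultimately obtain x where x: "x \<in> C"
    and min: "\<And>w k. w \<in> C \<Longrightarrow> k \<le> CARD('m) \<Longrightarrow> psum x k \<le> psum w k"
    using compact_meet_closed_has_bot[of C] by blast
  define y where "y = 2 *\<^sub>R z - x"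
  have xP: "x \<in> P" and yP: "y \<in> P" using x C by (auto simp: y_def)
  have "{..CARD('m)} \<subseteq> reach (tight x) (tight y)"
  proof (rule ccontr)
    assume unreached: "\<not> ?thesis"
    define S where "S = {..CARD('m)} - reach (tight x) (tight y)"
    \<comment> \<open>Both ends are reached, the last one through the full block tight at
      \<open>x\<close>, so \<open>S\<close> avoids them.\<close>
    have "0 \<in> reach (tight x) (tight y)" by (rule reach.zero)
    moreover from this have "CARD('m) \<in> reach (tight x) (tight y)"
      using full_tight[OF xP] by (rule reach.forward)
    ultimately have "k \<in> {1..<CARD('m)}" if "k \<in> S" for k
      using that by (cases "k = 0"; cases "k = CARD('m)") (auto simp: S_def)
    then have S: "S \<subseteq> {1..<CARD('m)}" by blast
    obtain k where k: "k \<in> S" using unreached by (auto simp: S_def)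
    \<comment> \<open>A block tight at \<open>x\<close> never leads from a reached index to an
      unreached one, so lowering \<open>S\<close> breaks no constraint; for \<open>y\<close> the
      blocks are read backwards.\<close>
    have "psum (- shift S) p \<le> psum (- shift S) q" if "(p, q) \<in> tight x" for p q
    proof -
      have "q \<in> S \<Longrightarrow> p \<in> S" using tightD[OF that] reach.forward[OF _ that] by (auto simp: S_def)
      then show ?thesis using tightD(1,2)[OF that] by (simp add: psum_shift[OF S] indicator_def)
    qed
    then have "\<forall>\<^sub>F e in at_right 0. x + e *\<^sub>R (- shift S) \<in> P \<and>
        tight (x + e *\<^sub>R (- shift S)) = {(p, q)\<in>tight x. psum (- shift S) p = psum (- shift S) q}"
      by (intro perturb[OF xP]) (simp_all add: shift_total[OF S])
    moreover have "psum (shift S) p \<le> psum (shift S) q" if "(p, q) \<in> tight y" for p q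
    proof -
      have "p \<in> S \<Longrightarrow> q \<in> S" using tightD[OF that] reach.backward[OF _ that] by (auto simp: S_def)
      then show ?thesis using tightD(1,2)[OF that] by (simp add: psum_shift[OF S] indicator_def)
    qed
    then have "\<forall>\<^sub>F e in at_right 0. y + e *\<^sub>R shift S \<in> P \<and>
        tight (y + e *\<^sub>R shift S) = {(p, q)\<in>tight y. psum (shift S) p = psum (shift S) q}"
      by (intro perturb[OF yP]) (simp_all add: shift_total[OF S])
    moreover have "\<forall>\<^sub>F e in at_right (0::real). 0 < e" by (rule eventually_at_right_less)
    ultimately have "\<forall>\<^sub>F e in at_right (0::real). 0 < e \<and> x + e *\<^sub>R (- shift S) \<in> P \<and> y + e *\<^sub>R shift S \<in> P"
      by eventually_elim auto
    then obtain e where e: "0 < e" "x + e *\<^sub>R (- shift S) \<in> P" "y + e *\<^sub>R shift S \<in> P"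
      using eventually_happens'[OF trivial_limit_at_right_real] by blast
    have "2 *\<^sub>R z - (x + e *\<^sub>R (- shift S)) = y + e *\<^sub>R shift S" by (simp add: y_def)
    then have "x + e *\<^sub>R (- shift S) \<in> C" using e C by metis
    moreover have km: "k \<le> CARD('m)" using k S by auto
    ultimately have "psum x k \<le> psum (x + e *\<^sub>R (- shift S)) k" by (rule min)
    then show False using e(1) k by (simp add: psum_shift[OF S km])
  qed
  moreover have "z = midpoint x y" by (simp add: midpoint_def y_def)
  ultimately show ?thesis using that xP yP by blast
qed

section \<open>Dimension of faces\<close>

lemma dim_flat_subspace:
  assumes N: "laminar N" "N \<subseteq> ivals CARD('m)"
  shows "dim {d :: real ^ 'm::{finite,linorder}. \<forall>(p, q)\<in>N. psum d p = psum d q} + card N = CARD('m)"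
proof -
  have fin: "finite N" using N(2) by (rule finite_subset) simp
  \<comment> \<open>The subspace is the orthogonal complement of the normal vectors
    \<open>g\<close>, so the point is their linear independence.\<close>
  define g where "g = (\<lambda>(p, q). of_psum (\<lambda>k. real (min (max k p) q)) :: real ^ 'm::{finite,linorder})"
  have g: "g (p, q) \<bullet> d = psum d q - psum d p" if "(p, q) \<in> N" for p q d
    using psum_inner[of p q d] ivalsD[OF that N(2)] by (simp add: g_def)
  \<comment> \<open>Prescribing the difference 1 on \<open>I\<close> and 0 on the other blocks,
    possible by laminarity, gives a vector dual to the normal of \<open>I\<close>.\<close>
  have dual: "\<exists>d. \<forall>J\<in>N. g J \<bullet> d = (if J = I then 1 else 0)" for I
  proof -
    obtain c where c: "\<forall>(p, q)\<in>N. c q - c p = (if (p, q) = I then 1 else 0 :: real)"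
      using laminar_prescribed_differences[OF fin N(1), where c = "\<lambda>J. if J = I then 1 else 0"]
        ivalsD[OF _ N(2)] by blast
    have "g J \<bullet> of_psum c = (if J = I then 1 else 0)" if "J \<in> N" for J
    proof -
      obtain p q where pq: "J = (p, q)" by fastforce
      then show ?thesis using g[of p q] c that ivalsD[of p q N "CARD('m)"] N(2)
        by (fastforce simp: psum_of_psum)
    qed
    then show ?thesis by blast
  qed
  have inj: "inj_on g N"
  proof (rule inj_onI)
    fix I J assume IJ: "I \<in> N" "J \<in> N" "g I = g J"
    obtain d where d: "\<forall>J\<in>N. g J \<bullet> d = (if J = I then 1 else 0)" using dual by blast
    have "g I \<bullet> d = 1" using d IJ(1) by simp
    moreover have "g J \<bullet> d = (if J = I then 1 else 0)" using d IJ(2) by blast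
    ultimately show "I = J" using IJ(3) by (metis zero_neq_one)
  qed
  have "independent (g ` N)"
    unfolding dependent_def
  proof
    assume "\<exists>a\<in>g ` N. a \<in> span (g ` N - {a})"
    then obtain I where I: "I \<in> N" "g I \<in> span (g ` N - {g I})" by blast
    obtain d where d: "\<forall>J\<in>N. g J \<bullet> d = (if J = I then 1 else 0)" using dual by blast
    have "orthogonal d a" if "a \<in> g ` N - {g I}" for a
      using that d by (auto simp: orthogonal_def inner_commute)
    then have "orthogonal d (g I)" using I(2) orthogonal_to_span by blast
    then show False using d I(1) by (simp add: orthogonal_def inner_commute)
  qed
  then have card: "dim (span (g ` N)) = card N"
    by (simp add: dim_eq_card_independent card_image[OF inj])
  have "(\<forall>x\<in>span (g ` N). orthogonal x d) \<longleftrightarrow> (\<forall>(p, q)\<in>N. psum d p = psum d q)" for d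
  proof
    assume h: "\<forall>x\<in>span (g ` N). orthogonal x d"
    show "\<forall>(p, q)\<in>N. psum d p = psum d q"
    proof clarify
      fix p q assume pq: "(p, q) \<in> N"
      then have "orthogonal (g (p, q)) d" using h span_base by blast
      then show "psum d p = psum d q" using g[OF pq] by (simp add: orthogonal_def)
    qed
  next
    assume h: "\<forall>(p, q)\<in>N. psum d p = psum d q"
    have "orthogonal d a" if "a \<in> g ` N" for a
      using that h g by (fastforce simp: orthogonal_def inner_commute)
    then show "\<forall>x\<in>span (g ` N). orthogonal x d"
      using orthogonal_to_span orthogonal_commute by blast
  qed
  then show ?thesis
    using dim_subspace_orthogonal_to_vectors[of "span (g ` N)" UNIV] card by simp
qed

text \<open>Near a point \<open>y\<close> at which exactly \<open>N\<close> is tight, the face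
  contains small steps in all directions flat across \<open>N\<close>. The assumption
  \<open>full\<close> makes the fixed total one of the constraints in \<open>N\<close>.\<close>

lemma aff_dim_face_set:
  assumes ne: "face_set N \<noteq> {}" and full: "(0, CARD('m)) \<in> N"
  shows "aff_dim (face_set N) = int CARD('m) - int (card N)"
proof -
  obtain x where x: "x \<in> face_set N" using ne by blast
  have xP: "x \<in> P" and N: "N \<subseteq> tight x" using face_setD[OF x] by auto
  \<comment> \<open>With difference 0 on \<open>N\<close> and 1 on the other tight blocks, a small
    step frees exactly the blocks outside \<open>N\<close>.\<close>
  obtain c where c: "\<forall>(p, q)\<in>tight x. c q - c p = (if (p, q) \<in> N then 0 else 1 :: real)"
    using laminar_prescribed_differences[OF finite_tight laminar_tight[OF xP] tightD(1)[of _ _ x],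
        where c = "\<lambda>I. if I \<in> N then 0 else 1"] by blast
  define d where "d = (of_psum c :: real ^ 'm::{finite,linorder})"
  have d: "psum d q - psum d p = (if (p, q) \<in> N then 0 else 1)" if "(p, q) \<in> tight x" for p q
    using tightD(1,2)[OF that] c that by (auto simp: d_def psum_of_psum)
  have "psum d CARD('m) = 0" using d[of 0 "CARD('m)"] full N by auto
  moreover have "psum d p \<le> psum d q" if "(p, q) \<in> tight x" for p q
    using d[OF that] by (auto split: if_splits)
  ultimately obtain e where e: "x + e *\<^sub>R d \<in> P"
    "tight (x + e *\<^sub>R d) = {(p, q)\<in>tight x. psum d p = psum d q}"
    using perturbE[OF xP, of d] by blast
  define y where "y = x + e *\<^sub>R d"
  have "psum d p = psum d q \<longleftrightarrow> (p, q) \<in> N" if "(p, q) \<in> tight x" for p q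
    using d[OF that] by (auto split: if_splits)
  then have y: "y \<in> P" "tight y = N"
    using e N by (auto simp: y_def)
  define L where "L = {d :: real ^ 'm::{finite,linorder}. \<forall>(p, q)\<in>N. psum d p = psum d q}"
  define S where "S = (\<lambda>w. w - y) ` face_set N"
  have "S \<subseteq> L"
  proof
    fix u assume "u \<in> S"
    then obtain w where w: "u = w - y" "w \<in> face_set N" by (auto simp: S_def)
    have "psum u p = psum u q" if "(p, q) \<in> N" for p q
    proof -
      have "(p, q) \<in> tight w" "(p, q) \<in> tight y" using that face_setD(2)[OF w(2)] y(2) by auto
      then show ?thesis using tightD(3)[of p q w] tightD(3)[of p q y] w(1) by simp
    qed
    then show "u \<in> L" by (auto simp: L_def)
  qed
  moreover have "L \<subseteq> span S"
  proof
    fix u assume u: "u \<in> L"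
    then have flat: "psum u p = psum u q" if "(p, q) \<in> tight y" for p q
      using that y(2) by (auto simp: L_def)
    have "psum u CARD('m) = 0" using flat[of 0 "CARD('m)"] full y(2) by simp
    moreover have "psum u p \<le> psum u q" if "(p, q) \<in> tight y" for p q using flat[OF that] by simp
    ultimately obtain e where e: "0 < e" "y + e *\<^sub>R u \<in> P"
      "tight (y + e *\<^sub>R u) = {(p, q)\<in>tight y. psum u p = psum u q}"
      using perturbE[OF y(1), of u] by blast
    have "N \<subseteq> tight (y + e *\<^sub>R u)" using e(3) flat y(2) by auto
    then have "y + e *\<^sub>R u \<in> face_set N" using e(2) by (simp add: face_set_def)
    then have "e *\<^sub>R u \<in> S" unfolding S_def by (intro image_eqI) auto
    then have "(1 / e) *\<^sub>R (e *\<^sub>R u) \<in> span S" by (intro span_mul span_base)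
    then show "u \<in> span S" using e(1) by simp
  qed
  ultimately have "dim S = dim L"
    by (metis antisym dim_span dim_subset)
  moreover have "aff_dim (face_set N) = int (dim S)"
  proof -
    have "y \<in> face_set N" using y by (simp add: face_set_def)
    then have "0 \<in> affine hull S" unfolding S_def by (intro hull_inc) auto
    then show ?thesis
      using aff_dim_zero[of S] aff_dim_translation_eq_subtract[of y "face_set N"] by (simp add: S_def)
  qed
  moreover have "dim L + card N = CARD('m)"
    unfolding L_def
  proof (rule dim_flat_subspace)
    show "laminar N" using laminar_subset[OF laminar_tight[OF xP] N] .
    show "N \<subseteq> ivals CARD('m)" using N tight_subset by blast
  qed
  ultimately show ?thesis by simp
qed

section \<open>The image as a union of products of faces\<close>

lemma diagonal_image:
  "diagonal v P ` P = \<Union>{F \<times> G | F G.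
     F face_of P \<and> F \<noteq> {} \<and> G face_of P \<and> G \<noteq> {} \<and>
     vertex_le \<omega> (top_vertex v F) (bot_vertex v G) \<and>
     aff_dim F + aff_dim G = int CARD('m) - 1}" (is "_ = \<Union>?R")
proof
  show "diagonal v P ` P \<subseteq> \<Union>?R"
  proof
    fix u assume "u \<in> diagonal v P ` P"
    then obtain z where z: "z \<in> P" "u = diagonal v P z" by blast
    obtain x y where xy: "x \<in> P" "y \<in> P" "z = midpoint x y"
      and reach: "{..CARD('m)} \<subseteq> reach (tight x) (tight y)"
      using reach_of_diagonal[OF z(1)] by blast
    have u: "u = (x, y)" using diagonal_of_reach[OF xy(1,2) reach] z(2) xy(3) by simp
    \<comment> \<open>The arborescence has \<open>CARD('m)\<close> edges. The dimension formula
      wants the full block in both families, so it is added to \<open>B\<close>; the two families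
      then have \<open>CARD('m) + 1\<close> members together, and the dimensions sum to
      \<open>CARD('m) - 1\<close>.\<close>
    obtain A B where AB: "A \<subseteq> tight x" "B \<subseteq> tight y" "(0, CARD('m)) \<in> A" "(0, CARD('m)) \<notin> B"
      "card A + card B = CARD('m)" "{..CARD('m)} \<subseteq> reach A B"
      using reach_arborescence[OF tight_subset tight_subset reach full_tight[OF xy(1)]] by auto
    define B' where "B' = insert (0, CARD('m)) B"
    have finB: "finite B" using AB(2) by (rule finite_subset) simp
    have B'y: "B' \<subseteq> tight y" using AB(2) full_tight[OF xy(2)] by (auto simp: B'_def)
    have xF: "x \<in> face_set A" and yG: "y \<in> face_set B'"
      using xy AB(1) B'y by (simp_all add: face_set_def)
    have reach': "{..CARD('m)} \<subseteq> reach A B'"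
      using AB(6) reach_mono[of A A B B'] by (auto simp: B'_def)
    have linked: "linked CARD('m) A B'"
    proof (rule reach_imp_linked[OF _ _ _ reach'])
      show "laminar B'" using laminar_subset[OF laminar_tight[OF xy(2)] B'y] .
      show "A \<subseteq> ivals CARD('m)" "B' \<subseteq> ivals CARD('m)" using AB(1) B'y tight_subset by blast+
    qed
    obtain s where s: "s \<in> PBT (length \<omega>)" "is_top A (loday_vertex s \<omega>)"
      "top_vertex v (face_set A) = loday_vertex s \<omega>" using face_set_top[of A] xF by blast
    obtain t where t: "t \<in> PBT (length \<omega>)" "is_bot B' (loday_vertex t \<omega>)"
      "bot_vertex v (face_set B') = loday_vertex t \<omega>" using face_set_bot[of B'] yG by blast
    have "tamari_le s t"
      using linked_imp_tamari_le[OF s(1) _ t(1) _ linked] s(2) t(2) by (simp add: is_top_def is_bot_def)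
    then have "vertex_le \<omega> (top_vertex v (face_set A)) (bot_vertex v (face_set B'))"
      unfolding vertex_le_def using s t by blast
    moreover have "aff_dim (face_set A) + aff_dim (face_set B') = int CARD('m) - 1"
    proof -
      have "aff_dim (face_set A) = int CARD('m) - int (card A)"
        using xF AB(3) by (intro aff_dim_face_set) auto
      moreover have "aff_dim (face_set B') = int CARD('m) - int (card B')"
        using yG by (intro aff_dim_face_set) (auto simp: B'_def)
      moreover have "card B' = Suc (card B)" using finB AB(4) by (simp add: B'_def)
      ultimately show ?thesis using AB(5) by linarith
    qed
    ultimately have "face_set A \<times> face_set B' \<in> ?R"
      using xF yG face_of_face_set by blast
    then show "u \<in> \<Union>?R" using u xF yG by blast
  qed
  show "\<Union>?R \<subseteq> diagonal v P ` P"
  proof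
    fix u assume "u \<in> \<Union>?R"
    then obtain F G x y where FG: "F face_of P" "F \<noteq> {}" "G face_of P" "G \<noteq> {}"
      "vertex_le \<omega> (top_vertex v F) (bot_vertex v G)" and u: "u = (x, y)" "x \<in> F" "y \<in> G" by blast
    \<comment> \<open>The blocks tight at \<open>x0\<close> are tight on all of \<open>F\<close>,
      and likewise for \<open>y0\<close> and \<open>G\<close>; so reachability shown for these two
      points passes to \<open>x\<close> and \<open>y\<close>.\<close>
    obtain x0 where x0: "x0 \<in> F" "F = face_set (tight x0)" using face_eq_face_set[OF FG(1,2)] .
    obtain y0 where y0: "y0 \<in> G" "G = face_set (tight y0)" using face_eq_face_set[OF FG(3,4)] .
    have xP: "x \<in> P" "y \<in> P" "x0 \<in> P" "y0 \<in> P"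
      using u x0 y0 face_of_imp_subset FG(1,3) by blast+
    obtain s' where s': "is_top (tight x0) (loday_vertex s' \<omega>)" "top_vertex v F = loday_vertex s' \<omega>"
      using face_set_top[of "tight x0"] x0 by blast
    obtain t' where t': "is_bot (tight y0) (loday_vertex t' \<omega>)" "bot_vertex v G = loday_vertex t' \<omega>"
      using face_set_bot[of "tight y0"] y0 by blast
    \<comment> \<open>\<open>vertex_le\<close> brings trees of its own; they are matched with the
      top and bottom through their vertices, which are all that \<open>is_top\<close> and
      \<open>is_bot\<close> refer to.\<close>
    obtain s t where st: "s \<in> PBT (length \<omega>)" "t \<in> PBT (length \<omega>)" "tamari_le s t"
      "top_vertex v F = loday_vertex s \<omega>" "bot_vertex v G = loday_vertex t \<omega>"
      using FG(5) unfolding vertex_le_def by blast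
    have "linked CARD('m) (tight x0) (tight y0)"
    proof (rule tamari_le_imp_linked[OF st(1) _ st(2) _ st(3) full_tight[OF xP(3)]])
      show "is_top (tight x0) (loday_vertex s \<omega>)" using s' st(4) by simp
      show "is_bot (tight y0) (loday_vertex t \<omega>)" using t' st(5) by simp
    qed
    then have "{..CARD('m)} \<subseteq> reach (tight x0) (tight y0)"
      by (intro linked_imp_reach laminar_tight tight_subset xP)
    moreover have "tight x0 \<subseteq> tight x" "tight y0 \<subseteq> tight y"
      using u x0(2) y0(2) face_setD(2) by blast+
    ultimately have "{..CARD('m)} \<subseteq> reach (tight x) (tight y)"
      using reach_mono[of "tight x0" "tight x" "tight y0" "tight y"] by blast
    then have "u = diagonal v P (midpoint x y)" using diagonal_of_reach[OF xP(1,2)] u(1) by simp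
    moreover have "midpoint x y \<in> P"
      using convexD[OF convex_P xP(1,2), of "1/2" "1/2"]
      by (simp add: midpoint_def scaleR_add_right inverse_eq_divide)
    ultimately show "u \<in> diagonal v P ` P" by blast
  qed
qed

end

theorem theorem2:
  fixes n :: nat and \<omega> :: "nat list" and v :: "real ^ 'm::{finite,linorder}"
  assumes "n \<ge> 2"
    and "CARD('m) = n - 1"
    and "is_weight n \<omega>"
    and "\<And>i j. i < j \<Longrightarrow> v $ i > v $ j"
  shows "diagonal v (loday_polytope \<omega>) ` (loday_polytope \<omega> :: (real ^ 'm::{finite,linorder}) set) =
    \<Union>{F \<times> G | F G.
        F face_of loday_polytope \<omega> \<and> F \<noteq> {} \<and>
        G face_of loday_polytope \<omega> \<and> G \<noteq> {} \<and>
        vertex_le \<omega> (top_vertex v F) (bot_vertex v G) \<and>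
        aff_dim F + aff_dim G = int n - 2}"
proof -
  have n: "n = Suc CARD('m)" using assms(1,2) by simp
  interpret loday_realization \<omega> v
    by unfold_locales (use assms(3,4) n in \<open>auto simp: is_weight_def\<close>)
  have "int n - 2 = int CARD('m) - 1" using n by simp
  then show ?thesis unfolding loday_polytope_eq using diagonal_image by simp
qed

end
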